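(* Let $d\ge 3$ and let $\Omega\subset\mathbb{R}^d$ be an admissible domain with $|\Omega|=|\mathbb{B}^d|$. Then for every nonnegative nonatomic Radon measure $\mu\in\mathcal{M}^c_+(\overline{\Omega})$ one has $$\overline{\lambda}^N_1(\Omega,\mu)\le\int_{\mathbb{B}^d}|\mathrm{d}u_0|^2,\qquad\text{where } u_0(x)=\frac{x}{|x|}.$$ If equality is achieved, then $\Omega$ is a.e. isometric to $\mathbb{B}^d$ and $\mu$ is proportional to $\frac{1}{|x|^2}$ (under this identification).
   Context: A domain is an open set, not necessarily connected. $\mathbb{B}^d\subset\mathbb{R}^d$ is the open unit ball centered at $0$; $|\Omega|$ is Lebesgue measure. $u_0\colon\mathbb{B}^d\to\mathbb{S}^{d-1}$, $u_0(x)=x/|x|$, is the equator map; $|\mathrm{d}u_0|^2=(d-1)/|x|^2$. $H^1\cap C^0(\overline{\Omega})$ denotes the functions continuous on $\overline{\Omega}$ whose restriction to $\Omega$ lies in the Sobolev space $H^1(\Omega)$. A bounded domain $\Omega\subset\mathbb{R}^d$ is called admissible if: (i) $H^1\cap C^0(\overline{\Omega})$ is dense in $H^1(\Omega)$; (ii) the embedding $H^1(\Omega)\to L^2(\Omega)$ is compact; (iii) $\overline{\Omega}=\bigsqcup_i\overline{\Omega}_i$ (disjoint union), where $\Omega_i$ are the connected components of $\Omega$. $\mathcal{M}_+(\overline{\Omega})$ is the set of nonnegative Radon measures on $\overline{\Omega}$, and $\mathcal{M}^c_+(\overline{\Omega})$ the subset of continuous (nonatomic) ones. For $\mu\in\mathcal{M}_+(\overline{\Omega})$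 and an integer $k\ge 0$, $$\lambda^N_k(\Omega,\mu):=\inf_{V_{k+1}}\ \sup_{\varphi\in V_{k+1}\setminus\{0\}}\frac{\int_\Omega|\mathrm{d}\varphi|^2\,\mathrm{d}x}{\int_{\overline{\Omega}}\varphi^2\,\mathrm{d}\mu}\in[0,\infty],$$ where $V_{k+1}$ runs over all $(k+1)$-dimensional subspaces of $H^1\cap C^0(\overline{\Omega})$, quotients with zero denominator being read as $+\infty$. Set $\overline{\lambda}^N_k(\Omega,\mu)=\mu(\overline{\Omega})\,\lambda^N_k(\Omega,\mu)$, with $\overline{\lambda}^N_k(\Omega,0)=0$. A function $f\in L^1$ is identified with the measure $f(x)\,\mathrm{d}x$. "$\Omega$ is a.e. isometric to $\mathbb{B}^d$ and $\mu$ is proportional to $\frac1{|x|^2}$" means: there is an isometry of $\mathbb{R}^d$ after which $\Omega$ and $\mathbb{B}^d$ differ by a Lebesgue-null set and $\mu=C|x|^{-2}\mathrm{d}x$ for a constant $C>0$. *)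

theory Defs
  imports "HOL-Analysis.Analysis" "HOL-Library.Function_Algebras"
begin

section \<open>Sobolev space\<close>

text \<open>\<open>Ck k f\<close>: \<open>f\<close> is of class \<open>C\<^sup>k\<close> on the whole space. Membership in \<open>C\<^sup>k\<^sup>+\<^sup>1\<close> means that
  \<open>f\<close> is differentiable and all its first partial derivatives are of class \<open>C\<^sup>k\<close>.\<close>

fun Ck :: "nat \<Rightarrow> ('a::euclidean_space \<Rightarrow> real) \<Rightarrow> bool" where
  "Ck 0 f \<longleftrightarrow> continuous_on UNIV f"
| "Ck (Suc k) f \<longleftrightarrow> (\<forall>x. f differentiable (at x)) \<and>
     (\<forall>b\<in>Basis. Ck k (\<lambda>x. frechet_derivative f (at x) b))"

definition test_functions :: "'a::euclidean_space set \<Rightarrow> ('a \<Rightarrow> real) set" where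
  "test_functions \<Omega> =
     {\<psi>. (\<forall>k. Ck k \<psi>) \<and> compact (closure {x. \<psi> x \<noteq> 0}) \<and> closure {x. \<psi> x \<noteq> 0} \<subseteq> \<Omega>}"

definition L2 :: "'a::euclidean_space set \<Rightarrow> ('a \<Rightarrow> 'b::euclidean_space) set" where
  "L2 \<Omega> = {f \<in> borel_measurable (lebesgue_on \<Omega>). integrable (lebesgue_on \<Omega>) (\<lambda>x. (norm (f x))\<^sup>2)}"

definition L2_norm :: "'a::euclidean_space set \<Rightarrow> ('a \<Rightarrow> 'b::euclidean_space) \<Rightarrow> real" where
  "L2_norm \<Omega> f = sqrt (LINT x|lebesgue_on \<Omega>. (norm (f x))\<^sup>2)"

definition is_weak_gradient ::
  "'a::euclidean_space set \<Rightarrow> ('a \<Rightarrow> real) \<Rightarrow> ('a \<Rightarrow> 'a) \<Rightarrow> bool" where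
  "is_weak_gradient \<Omega> f g \<longleftrightarrow>
     (\<forall>K. compact K \<and> K \<subseteq> \<Omega> \<longrightarrow> integrable (lebesgue_on K) f \<and> integrable (lebesgue_on K) g) \<and>
     (\<forall>\<psi>\<in>test_functions \<Omega>. \<forall>b\<in>Basis.
        (LINT x|lebesgue_on \<Omega>. f x * frechet_derivative \<psi> (at x) b) =
        - (LINT x|lebesgue_on \<Omega>. (g x \<bullet> b) * \<psi> x))"

text \<open>A weak gradient on an open set is unique up to null sets, so the choice below affects
  none of the integrals in which it is used.\<close>

definition weak_gradient :: "'a::euclidean_space set \<Rightarrow> ('a \<Rightarrow> real) \<Rightarrow> 'a \<Rightarrow> 'a" where
  "weak_gradient \<Omega> f = (SOME g. is_weak_gradient \<Omega> f g)"

text \<open>Elements of \<open>L2\<close> and \<open>H1\<close> are functions rather than classes modulo null sets; their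
  values outside \<open>\<Omega>\<close> are irrelevant.\<close>

definition H1 :: "'a::euclidean_space set \<Rightarrow> ('a \<Rightarrow> real) set" where
  "H1 \<Omega> = {f \<in> L2 \<Omega>. \<exists>g\<in>L2 \<Omega>. is_weak_gradient \<Omega> f g}"

definition H1_norm :: "'a::euclidean_space set \<Rightarrow> ('a \<Rightarrow> real) \<Rightarrow> real" where
  "H1_norm \<Omega> f = sqrt ((L2_norm \<Omega> f)\<^sup>2 + (L2_norm \<Omega> (weak_gradient \<Omega> f))\<^sup>2)"

text \<open>A function on \<open>closure \<Omega>\<close> is encoded by its extension by zero to the whole space, so that
  equality, linear (in)dependence and dimension are those of functions on \<open>closure \<Omega>\<close>.\<close>

definition H1C0 :: "'a::euclidean_space set \<Rightarrow> ('a \<Rightarrow> real) set" where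
  "H1C0 \<Omega> = {\<phi> \<in> H1 \<Omega>. continuous_on (closure \<Omega>) \<phi> \<and> (\<forall>x. x \<notin> closure \<Omega> \<longrightarrow> \<phi> x = 0)}"

section \<open>Admissible domains\<close>

definition compact_embedding_H1_L2 :: "'a::euclidean_space set \<Rightarrow> bool" where
  "compact_embedding_H1_L2 \<Omega> \<longleftrightarrow>
     (\<forall>F::nat \<Rightarrow> 'a \<Rightarrow> real. (\<forall>n. F n \<in> H1 \<Omega>) \<and> bounded (range (\<lambda>n. H1_norm \<Omega> (F n))) \<longrightarrow>
        (\<exists>f\<in>L2 \<Omega>. \<exists>r. strict_mono r \<and> (\<lambda>n. L2_norm \<Omega> (\<lambda>x. F (r n) x - f x)) \<longlonglongrightarrow> 0))"

definition admissible_domain :: "'a::euclidean_space set \<Rightarrow> bool" where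
  "admissible_domain \<Omega> \<longleftrightarrow>
     open \<Omega> \<and> bounded \<Omega> \<and>
     (\<forall>f\<in>H1 \<Omega>. \<forall>\<epsilon>>0. \<exists>\<phi>\<in>H1C0 \<Omega>. H1_norm \<Omega> (\<lambda>x. f x - \<phi> x) < \<epsilon>) \<and>
     compact_embedding_H1_L2 \<Omega> \<and>
     closure \<Omega> = (\<Union>C\<in>components \<Omega>. closure C) \<and>
     (\<forall>C\<in>components \<Omega>. \<forall>D\<in>components \<Omega>. C \<noteq> D \<longrightarrow> closure C \<inter> closure D = {})"

section \<open>Measures\<close>

definition radon_measure_on :: "'a::euclidean_space set \<Rightarrow> 'a measure \<Rightarrow> bool" where
  "radon_measure_on X \<mu> \<longleftrightarrow>
     sets \<mu> = sets (restrict_space borel X) \<and>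
     (\<forall>K. compact K \<and> K \<subseteq> X \<longrightarrow> emeasure \<mu> K < \<infinity>) \<and>
     (\<forall>A\<in>sets \<mu>. emeasure \<mu> A = (SUP K\<in>{K. compact K \<and> K \<subseteq> A}. emeasure \<mu> K))"

definition nonatomic :: "'a measure \<Rightarrow> bool" where
  "nonatomic \<mu> \<longleftrightarrow> (\<forall>x\<in>space \<mu>. emeasure \<mu> {x} = 0)"

section \<open>Neumann eigenvalues\<close>

interpretation fun_space: vector_space "\<lambda>(c::real) (f::'a \<Rightarrow> real) x. c * f x"
  by unfold_locales (auto simp: fun_eq_iff algebra_simps)

definition dirichlet_energy :: "'a::euclidean_space set \<Rightarrow> ('a \<Rightarrow> real) \<Rightarrow> ennreal" where
  "dirichlet_energy \<Omega> \<phi> = (\<integral>\<^sup>+x. ennreal ((norm (weak_gradient \<Omega> \<phi> x))\<^sup>2) \<partial>lebesgue_on \<Omega>)"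

text \<open>The case distinction is needed because \<open>0 / 0 = 0\<close> in \<^typ>\<open>ennreal\<close>.\<close>

definition rayleigh_quotient ::
  "'a::euclidean_space set \<Rightarrow> 'a measure \<Rightarrow> ('a \<Rightarrow> real) \<Rightarrow> ennreal" where
  "rayleigh_quotient \<Omega> \<mu> \<phi> =
     (let D = (\<integral>\<^sup>+x. ennreal ((\<phi> x)\<^sup>2) \<partial>\<mu>)
      in if D = 0 then \<infinity> else dirichlet_energy \<Omega> \<phi> / D)"

definition neumann_eigenvalue ::
  "nat \<Rightarrow> 'a::euclidean_space set \<Rightarrow> 'a measure \<Rightarrow> ennreal" where
  "neumann_eigenvalue k \<Omega> \<mu> =
     (INF V\<in>{V. fun_space.subspace V \<and> V \<subseteq> H1C0 \<Omega> \<and> fun_space.dim V = k + 1}.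
        SUP \<phi>\<in>V - {0}. rayleigh_quotient \<Omega> \<mu> \<phi>)"

definition normalized_neumann_eigenvalue ::
  "nat \<Rightarrow> 'a::euclidean_space set \<Rightarrow> 'a measure \<Rightarrow> ennreal" where
  "normalized_neumann_eigenvalue k \<Omega> \<mu> =
     (if emeasure \<mu> (closure \<Omega>) = 0 then 0
      else emeasure \<mu> (closure \<Omega>) * neumann_eigenvalue k \<Omega> \<mu>)"

section \<open>The equator map\<close>

definition equator_map :: "'a::euclidean_space \<Rightarrow> 'a" where
  "equator_map x = x /\<^sub>R norm x"

text \<open>The energy density is the squared Hilbert--Schmidt norm of the differential, which exists
  away from the null set \<open>{0}\<close>.\<close>

definition equator_energy :: "'a::euclidean_space itself \<Rightarrow> ennreal" where
  "equator_energy _ =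
     (\<integral>\<^sup>+x\<in>ball (0::'a) 1.
        ennreal (\<Sum>b\<in>Basis. (norm (frechet_derivative equator_map (at x) b))\<^sup>2) \<partial>lborel)"

definition isometry :: "('a::euclidean_space \<Rightarrow> 'a) \<Rightarrow> bool" where
  "isometry T \<longleftrightarrow> surj T \<and> (\<forall>x y. dist (T x) (T y) = dist x y)"

end

theory Submission
  imports Defs
begin

text \<open>
  Let \<open>c\<close> minimise \<open>\<integral> |x - c| d\<mu>\<close>. As \<open>\<mu>\<close> has no atoms, this function of \<open>c\<close> is differentiable, so
  \<open>u(x) = (x - c) / |x - c|\<close> has \<open>\<mu>\<close>-mean zero; no topological balancing argument is needed. Put
  \<open>M = \<mu>(closure \<Omega>)\<close> and \<open>\<lambda> = \<lambda>\<^sub>1(\<Omega>, \<mu>)\<close>. Testing \<open>\<lambda>\<close> with the coordinates of \<open>w u\<close> (regularised near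
  \<open>c\<close>) and summing gives, for every \<open>C\<^sup>1\<close> function \<open>w\<close>,
  \<open>\<lambda> (\<integral> w\<^sup>2 d\<mu> - |\<integral> w u d\<mu>|\<^sup>2 / M) \<le> \<integral>\<^sub>\<Omega> w\<^sup>2 (d - 1) / |x - c|\<^sup>2 + |\<nabla>w|\<^sup>2 dx\<close>.
  With \<open>w = 1\<close> the right-hand side is at most the energy of the equator map, since among sets of given
  volume the ball about \<open>c\<close> maximises the integral of \<open>1 / |x - c|\<^sup>2\<close>. In the case of equality \<open>\<Omega>\<close> is
  this ball up to a null set, and \<open>w = 1 + t \<psi>\<close> turns both sides into quadratic polynomials in \<open>t\<close>
  with the same constant term. Comparing the linear terms yields
  \<open>\<lambda> \<integral> \<psi> d\<mu> = \<integral>\<^sub>\<Omega> \<psi> (d - 1) / |x - c|\<^sup>2 dx\<close>, which determines \<open>\<mu>\<close>.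
\<close>

section \<open>Weak gradients of continuously differentiable functions\<close>

text \<open>The trial space for \<lambda> is spanned by 1 and a single function f. The energy
  ignores the added constant, and the denominator, minimised over that constant, is \<integral> f^2
  - (\<integral> f)^2 / M. This is the origin of the variance on the left-hand side, and it frees f
  from any mean-zero condition, so that \<open>w\<close> may be arbitrary. The condition |u| = 1
  makes the squares of the coordinates of w u add up to w^2 and removes the cross terms from the
  energy. Centring at the median matters twice: the correction vanishes for w = 1, and for w = 1 + t
  \<psi> it is of order t^2, so it leaves no trace in the linear terms. Since t may have either
  sign, their comparison is an equation. The dimension enters through the integrability of 1 /
  |x|^2, which also justifies the limit \<epsilon> to 0. The energy is defined through an
  arbitrarily chosen weak gradient. No test function can be evaluated before weak gradients are
  known to be unique almost everywhere and to agree with classical ones. The bumps built for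
  uniqueness serve again at the end, as the \<psi> that recover \<mu> on boxes.\<close>

definition C1_grad :: "('a::euclidean_space \<Rightarrow> real) \<Rightarrow> ('a \<Rightarrow> 'a) \<Rightarrow> bool" where
  "C1_grad f g \<longleftrightarrow> (\<forall>x. (f has_derivative (\<lambda>h. g x \<bullet> h)) (at x)) \<and> continuous_on UNIV g"

lemma C1_gradD:
  assumes "C1_grad f g"
  shows "(f has_derivative (\<lambda>h. g x \<bullet> h)) (at x)"
    and "continuous_on A f" and "continuous_on A g"
proof -
  show 1: "(f has_derivative (\<lambda>h. g x \<bullet> h)) (at x)" for x
    using assms by (auto simp: C1_grad_def)
  show "continuous_on A f"
    by (rule continuous_at_imp_continuous_on) (use 1 has_derivative_continuous in blast)
  show "continuous_on A g"
    using assms continuous_on_subset unfolding C1_grad_def by blast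
qed

lemma C1_grad_const: "C1_grad (\<lambda>_. c) (\<lambda>_. 0)"
  by (auto simp: C1_grad_def)

lemma C1_grad_add:
  assumes "C1_grad f g" "C1_grad f' g'"
  shows "C1_grad (\<lambda>x. f x + f' x) (\<lambda>x. g x + g' x)"
  using assms unfolding C1_grad_def
  by (auto intro!: derivative_eq_intros continuous_intros simp: inner_add_left)

lemma C1_grad_mult:
  assumes f: "C1_grad f g" and f': "C1_grad f' g'"
  shows "C1_grad (\<lambda>x. f x * f' x) (\<lambda>x. f x *\<^sub>R g' x + f' x *\<^sub>R g x)"
  unfolding C1_grad_def
proof (intro conjI allI)
  show "((\<lambda>x. f x * f' x) has_derivative (\<lambda>h. (f x *\<^sub>R g' x + f' x *\<^sub>R g x) \<bullet> h)) (at x)" for x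
    by (rule has_derivative_eq_rhs[OF has_derivative_mult[OF C1_gradD(1)[OF f] C1_gradD(1)[OF f']]])
       (auto simp: fun_eq_iff inner_add_left algebra_simps)
  show "continuous_on UNIV (\<lambda>x. f x *\<^sub>R g' x + f' x *\<^sub>R g x)"
    by (intro continuous_intros C1_gradD[OF f] C1_gradD[OF f'])
qed

lemma C1_grad_cmult:
  assumes "C1_grad f g"
  shows "C1_grad (\<lambda>x. c * f x) (\<lambda>x. c *\<^sub>R g x)"
  using C1_grad_mult[OF C1_grad_const[of c] assms] by simp

text \<open>Connects the recursive class \<open>Ck\<close>, which knows only partial derivatives,
  with explicit gradients: a linear map is determined by its values on the basis.\<close>

lemma C1_grad_Ck:
  assumes "Ck 1 f"
  shows "C1_grad f (\<lambda>x. \<Sum>b\<in>Basis. frechet_derivative f (at x) b *\<^sub>R b)"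
  unfolding C1_grad_def
proof (intro conjI allI)
  fix x
  have d: "f differentiable (at x)" using assms by simp
  then have D: "(f has_derivative frechet_derivative f (at x)) (at x)"
    by (simp add: frechet_derivative_works)
  interpret D: bounded_linear "frechet_derivative f (at x)"
    using D by (rule has_derivative_bounded_linear)
  have "frechet_derivative f (at x) h = (\<Sum>b\<in>Basis. frechet_derivative f (at x) b *\<^sub>R b) \<bullet> h" for h
  proof -
    have "frechet_derivative f (at x) h = frechet_derivative f (at x) (\<Sum>b\<in>Basis. (h \<bullet> b) *\<^sub>R b)"
      by (simp add: euclidean_representation)
    also have "\<dots> = (\<Sum>b\<in>Basis. (h \<bullet> b) * frechet_derivative f (at x) b)"
      by (simp add: D.sum D.scaleR)
    finally show ?thesis by (simp add: inner_sum_left inner_commute[of h] mult.commute)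
  qed
  then show "(f has_derivative (\<lambda>h. (\<Sum>b\<in>Basis. frechet_derivative f (at x) b *\<^sub>R b) \<bullet> h)) (at x)"
    using D by (metis (no_types, lifting) ext)
next
  show "continuous_on UNIV (\<lambda>x. \<Sum>b\<in>Basis. frechet_derivative f (at x) b *\<^sub>R b)"
    using assms by (auto intro!: continuous_intros)
qed

section \<open>Integration by parts against compactly supported functions\<close>

lemma integral_lborel_translate:
  fixes f :: "'a::euclidean_space \<Rightarrow> real"
  assumes "f \<in> borel_measurable borel"
  shows "(LINT x|lborel. f (x + v)) = (LINT x|lborel. f x)"
proof -
  have "(LINT x|lborel. f x) = (LINT x|distr lborel borel ((+) v). f x)"
    by (simp add: lborel_distr_plus)
  also have "\<dots> = (LINT x|lborel. f (v + x))"
    using assms by (subst integral_distr) auto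
  finally show ?thesis by (simp add: add.commute)
qed

lemma continuous_compact_support_integrable:
  fixes f :: "'a::euclidean_space \<Rightarrow> real"
  assumes f: "continuous_on UNIV f" and K: "compact K" and 0: "\<And>x. x \<notin> K \<Longrightarrow> f x = 0"
  shows "integrable lborel f"
proof -
  have "set_integrable lborel K f"
    unfolding set_integrable_def using K f by (intro borel_integrable_compact) (auto intro: continuous_on_subset)
  moreover have "(\<lambda>x. indicator K x *\<^sub>R f x) = f"
    using 0 by (auto simp: indicator_def fun_eq_iff)
  ultimately show ?thesis by (simp add: set_integrable_def)
qed

text \<open>The integral of the difference quotients in direction \<open>b\<close> vanishes by translation
  invariance.\<close>

lemma integral_partial_derivative_eq_0:
  fixes f :: "'a::euclidean_space \<Rightarrow> real"
  assumes f: "C1_grad f g" and K: "compact K" and 0: "\<And>x. x \<notin> K \<Longrightarrow> f x = 0"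
  shows "(LINT x|lborel. g x \<bullet> b) = 0"
proof -
  have g0: "g x = 0" if "x \<notin> K" for x
  proof -
    have "(f has_derivative (\<lambda>h. 0)) (at x)"
    proof (rule has_derivative_transform_within_open)
      show "((\<lambda>_. 0) has_derivative (\<lambda>h. 0)) (at x)" by simp
      show "open (- K)" using K by (simp add: compact_imp_closed open_Compl)
    qed (use 0 that in auto)
    with C1_gradD(1)[OF f, of x] have "(\<lambda>h. g x \<bullet> h) = (\<lambda>h. 0)"
      by (rule has_derivative_unique)
    then have "g x \<bullet> g x = 0" by metis
    then show ?thesis by simp
  qed
  have "bounded (g ` K)"
    using C1_gradD(3)[OF f, of K] K by (intro compact_imp_bounded compact_continuous_image)
  then obtain B where "\<forall>x\<in>K. norm (g x) \<le> B" by (auto simp: bounded_iff)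
  then have B: "norm (g x) \<le> max B 0" for x
    by (cases "x \<in> K") (auto simp: g0 intro: le_max_iff_disj[THEN iffD2])
  obtain R where R: "\<forall>x\<in>K. norm x \<le> R" using compact_imp_bounded[OF K] by (auto simp: bounded_iff)
  define t where "t n = 1 / real (Suc n)" for n
  have t: "t n > 0" "t n \<le> 1" for n by (auto simp: t_def divide_simps)
  have tlim: "t \<longlonglongrightarrow> 0" unfolding t_def by (rule lim_const_over_n[THEN LIMSEQ_Suc])
  define q where "q n x = (f (x + t n *\<^sub>R b) - f x) / t n" for n x
  have fm[measurable]: "f \<in> borel_measurable borel"
    using C1_gradD(2)[OF f] by (intro borel_measurable_continuous_onI)
  have gm[measurable]: "g \<in> borel_measurable borel"
    using C1_gradD(3)[OF f] by (intro borel_measurable_continuous_onI)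
  have int: "integrable lborel f"
    using continuous_compact_support_integrable[OF C1_gradD(2)[OF f] K 0] by simp
  have int': "integrable lborel (\<lambda>x. f (x + v))" for v
  proof (rule continuous_compact_support_integrable)
    show "continuous_on UNIV (\<lambda>x. f (x + v))"
      by (rule continuous_on_compose2[OF C1_gradD(2)[OF f, of UNIV]]) (auto intro: continuous_intros)
    show "compact ((\<lambda>x. x - v) ` K)" using K by (rule compact_translation_subtract)
    show "f (x + v) = 0" if "x \<notin> (\<lambda>x. x - v) ` K" for x
    proof (rule 0)
      show "x + v \<notin> K" using that by (metis add_diff_cancel image_eqI)
    qed
  qed
  have q0: "(LINT x|lborel. q n x) = 0" for n
    unfolding q_def using int int'[of "t n *\<^sub>R b"] integral_lborel_translate[of f "t n *\<^sub>R b"]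
    by simp
  have "(\<lambda>n. LINT x|lborel. q n x) \<longlonglongrightarrow> (LINT x|lborel. g x \<bullet> b)"
  proof (rule integral_dominated_convergence)
    \<comment> \<open>The quotients are bounded by the mean value inequality. As \<open>t n\<close>
      is at most 1, a shift moves a point by at most \<open>norm b\<close>, so all of them vanish
      outside one enlarged ball.\<close>
    show "integrable lborel (\<lambda>x. indicator (cball 0 (R + norm b)) x *\<^sub>R (max B 0 * norm b))"
      by (rule borel_integrable_compact) auto
    show "AE x in lborel. (\<lambda>n. q n x) \<longlonglongrightarrow> g x \<bullet> b"
    proof (rule AE_I2)
      fix x
      have "((\<lambda>s. f (x + s *\<^sub>R b)) has_derivative (\<lambda>s. g x \<bullet> (s *\<^sub>R b))) (at 0)"
        by (rule has_derivative_compose[of "\<lambda>s. x + s *\<^sub>R b" "\<lambda>s. s *\<^sub>R b" 0 UNIV f])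
           (use C1_gradD(1)[OF f] in \<open>auto intro!: derivative_eq_intros\<close>)
      then have "((\<lambda>s. f (x + s *\<^sub>R b)) has_field_derivative g x \<bullet> b) (at 0)"
        unfolding has_field_derivative_def
        by (rule has_derivative_eq_rhs) (simp add: fun_eq_iff)
      then have "((\<lambda>h. (f (x + h *\<^sub>R b) - f x) / h) \<longlongrightarrow> g x \<bullet> b) (at 0)"
        by (simp add: DERIV_def)
      moreover have "filterlim t (at 0) sequentially"
        using tlim t by (auto simp: filterlim_at intro!: always_eventually) (metis less_irrefl)
      ultimately show "(\<lambda>n. q n x) \<longlonglongrightarrow> g x \<bullet> b"
        unfolding q_def using filterlim_compose by blast
    qed
    show "AE x in lborel. norm (q n x) \<le> indicator (cball 0 (R + norm b)) x *\<^sub>R (max B 0 * norm b)" for n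
    proof (rule AE_I2)
      fix x
      have "norm (f (x + t n *\<^sub>R b) - f x) \<le> max B 0 * norm ((x + t n *\<^sub>R b) - x)"
      proof (rule differentiable_bound[of UNIV f "\<lambda>x h. g x \<bullet> h"])
        show "onorm (\<lambda>h. g y \<bullet> h) \<le> max B 0" for y
        proof (rule onorm_le)
          show "norm (g y \<bullet> h) \<le> max B 0 * norm h" for h
            using Cauchy_Schwarz_ineq2[of "g y" h] mult_right_mono[OF B[of y], of "norm h"] by simp
        qed
      qed (use C1_gradD(1)[OF f] in auto)
      then have 1: "norm (q n x) \<le> max B 0 * norm b"
        using t(1)[of n] by (simp add: q_def field_simps)
      have 2: "q n x = 0" if "x \<notin> cball 0 (R + norm b)"
      proof -
        have n: "norm x > R + norm b" using that by simp
        have "norm (t n *\<^sub>R b) \<le> norm b"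
          using t[of n] by (simp add: mult_left_le_one_le)
        then have "norm (x + t n *\<^sub>R b) > R"
          using n norm_diff_ineq[of x "t n *\<^sub>R b"] by linarith
        moreover have "norm x > R" using n norm_ge_zero[of b] by linarith
        ultimately have "f (x + t n *\<^sub>R b) = 0" "f x = 0" using R 0 by (meson not_less)+
        then show ?thesis by (simp add: q_def)
      qed
      show "norm (q n x) \<le> indicator (cball 0 (R + norm b)) x *\<^sub>R (max B 0 * norm b)"
        using 1 2 by (auto simp: indicator_def)
    qed
  qed (auto simp: q_def)
  then show ?thesis using q0 by (simp add: LIMSEQ_const_iff)
qed

lemma integrable_lebesgue_on_compact:
  fixes f :: "'a::euclidean_space \<Rightarrow> 'b::euclidean_space"
  assumes f: "continuous_on K f" and K: "compact K"
  shows "integrable (lebesgue_on K) f"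
proof -
  have "set_integrable lborel K f"
    unfolding set_integrable_def using K f by (intro borel_integrable_compact)
  then have "integrable lebesgue (\<lambda>x. indicator K x *\<^sub>R f x)"
    unfolding set_integrable_def by (subst integrable_completion) (auto dest: borel_measurable_integrable)
  then show ?thesis
    using K by (subst integrable_restrict_space) (auto simp: set_integrable_def compact_imp_closed borel_closed)
qed

lemma LINT_lebesgue_on_eq_lborel:
  fixes f :: "'a::euclidean_space \<Rightarrow> real"
  assumes "\<Omega> \<in> sets borel" "f \<in> borel_measurable borel" "\<And>x. x \<notin> \<Omega> \<Longrightarrow> f x = 0"
  shows "(LINT x|lebesgue_on \<Omega>. f x) = (LINT x|lborel. f x)"
proof -
  have "(\<lambda>x. indicator \<Omega> x *\<^sub>R f x) = f" using assms by (auto simp: indicator_def fun_eq_iff)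
  then have "(LINT x|lebesgue_on \<Omega>. f x) = (LINT x|lebesgue. f x)"
    using assms by (subst integral_restrict_space) auto
  also have "\<dots> = (LINT x|lborel. f x)"
    using assms by (intro integral_completion) auto
  finally show ?thesis .
qed

text \<open>The product of \<open>f\<close> with a test function has compact support, so the
  integral of its partial derivatives vanishes; the product rule turns this into the defining
  identity. Agreement of \<open>F\<close> and \<open>f\<close> on \<Omega> suffices, which admits
  functions cut off outside the closure.\<close>

lemma C1_grad_is_weak_gradient:
  fixes f :: "'a::euclidean_space \<Rightarrow> real"
  assumes f: "C1_grad f g" and \<Omega>: "open \<Omega>" and eq: "\<And>x. x \<in> \<Omega> \<Longrightarrow> F x = f x"
  shows "is_weak_gradient \<Omega> F g"
  unfolding is_weak_gradient_def
proof (intro conjI allI impI ballI)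
  fix K assume K: "compact K \<and> K \<subseteq> \<Omega>"
  have "continuous_on K F \<longleftrightarrow> continuous_on K f"
    using K eq by (intro continuous_on_cong) auto
  then show "integrable (lebesgue_on K) F"
    using K C1_gradD(2)[OF f] by (intro integrable_lebesgue_on_compact) auto
  show "integrable (lebesgue_on K) g"
    using K C1_gradD(3)[OF f] by (intro integrable_lebesgue_on_compact) auto
next
  fix \<psi> and b :: 'a assume \<psi>: "\<psi> \<in> test_functions \<Omega>" and b: "b \<in> Basis"
  define h where "h x = (\<Sum>b\<in>Basis. frechet_derivative \<psi> (at x) b *\<^sub>R b)" for x
  have "Ck 1 \<psi>" using \<psi> by (auto simp: test_functions_def)
  then have h: "C1_grad \<psi> h" unfolding h_def by (rule C1_grad_Ck)
  have hb: "h x \<bullet> b = frechet_derivative \<psi> (at x) b" for x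
    using frechet_derivative_at[OF C1_gradD(1)[OF h, of x]] by metis
  define K where "K = closure {x. \<psi> x \<noteq> 0}"
  have K: "compact K" "K \<subseteq> \<Omega>"
    using \<psi> by (auto simp: test_functions_def K_def)
  have 0: "\<psi> x = 0" if "x \<notin> K" for x
    using that closure_subset[of "{x. \<psi> x \<noteq> 0}"] by (auto simp: K_def)
  have h0: "h x = 0" if "x \<notin> K" for x
  proof -
    have "(\<psi> has_derivative (\<lambda>h. 0)) (at x)"
    proof (rule has_derivative_transform_within_open)
      show "((\<lambda>_. 0) has_derivative (\<lambda>h. 0)) (at x)" by simp
      show "open (- K)" using K by (simp add: compact_imp_closed open_Compl)
    qed (use 0 that in auto)
    with C1_gradD(1)[OF h, of x] have "(\<lambda>k. h x \<bullet> k) = (\<lambda>h. 0)"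
      by (rule has_derivative_unique)
    then have "h x \<bullet> h x = 0" by metis
    then show ?thesis by simp
  qed
  note fc = C1_gradD(2)[OF f, of UNIV] and gc = C1_gradD(3)[OF f, of UNIV]
    and pc = C1_gradD(2)[OF h, of UNIV] and hc = C1_gradD(3)[OF h, of UNIV]
  note [measurable] = fc[THEN borel_measurable_continuous_onI] gc[THEN borel_measurable_continuous_onI]
     pc[THEN borel_measurable_continuous_onI] hc[THEN borel_measurable_continuous_onI]
  have "(LINT x|lborel. (f x *\<^sub>R h x + \<psi> x *\<^sub>R g x) \<bullet> b) = 0"
    by (rule integral_partial_derivative_eq_0[OF C1_grad_mult[OF f h] K(1)]) (simp add: 0)
  moreover have "integrable lborel (\<lambda>x. f x * (h x \<bullet> b))"
    by (rule continuous_compact_support_integrable[OF _ K(1)])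
       (use fc hc in \<open>auto intro!: continuous_intros simp: h0\<close>)
  moreover have "integrable lborel (\<lambda>x. (g x \<bullet> b) * \<psi> x)"
    by (rule continuous_compact_support_integrable[OF _ K(1)])
       (use pc gc in \<open>auto intro!: continuous_intros simp: 0\<close>)
  ultimately have "(LINT x|lborel. f x * (h x \<bullet> b)) = - (LINT x|lborel. (g x \<bullet> b) * \<psi> x)"
    by (simp add: inner_add_left mult.commute)
  moreover have "(LINT x|lebesgue_on \<Omega>. F x * frechet_derivative \<psi> (at x) b) =
       (LINT x|lebesgue_on \<Omega>. f x * (h x \<bullet> b))"
    by (intro Bochner_Integration.integral_cong) (auto simp: eq hb)
  moreover have "(LINT x|lebesgue_on \<Omega>. f x * (h x \<bullet> b)) = (LINT x|lborel. f x * (h x \<bullet> b))"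
  proof (rule LINT_lebesgue_on_eq_lborel)
    show "f x * (h x \<bullet> b) = 0" if "x \<notin> \<Omega>" for x
      using that K(2) h0[of x] by (metis inner_zero_left mult_zero_right subsetD)
  qed (use \<Omega> in auto)
  moreover have "(LINT x|lebesgue_on \<Omega>. (g x \<bullet> b) * \<psi> x) = (LINT x|lborel. (g x \<bullet> b) * \<psi> x)"
    using \<Omega> K 0 by (intro LINT_lebesgue_on_eq_lborel) auto
  ultimately show "(LINT x|lebesgue_on \<Omega>. F x * frechet_derivative \<psi> (at x) b) =
        - (LINT x|lebesgue_on \<Omega>. (g x \<bullet> b) * \<psi> x)"
    by simp
qed

section \<open>Smooth bump functions on boxes\<close>

text \<open>The classical flat function exp(-1/t), extended by 0, together with the negative powers
  of t that differentiation produces: the span of the family over \<open>m\<close> is closed under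
  derivatives.\<close>

definition flat_exp :: "nat \<Rightarrow> real \<Rightarrow> real" where
  "flat_exp m t = (if t > 0 then exp (- (1 / t)) / t ^ m else 0)"

lemma flat_exp_tendsto_0: "((\<lambda>t::real. exp (- (1 / t)) / t ^ m) \<longlongrightarrow> 0) (at_right 0)"
proof -
  have "((\<lambda>t::real. (inverse t) ^ m / exp (inverse t)) \<longlongrightarrow> 0) (at_right 0)"
    by (rule filterlim_compose[OF tendsto_power_div_exp_0 filterlim_inverse_at_top_right])
  then show ?thesis
    by (simp add: exp_minus field_simps)
qed

lemma DERIV_flat_exp:
  "(flat_exp m has_real_derivative (flat_exp (m + 2) t - real m * flat_exp (m + 1) t)) (at t)"
proof -
  consider "t > 0" | "t < 0" | "t = 0" by linarith
  then show ?thesis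
  proof cases
    case 1
    have "((\<lambda>t. exp (- (1 / t)) / t ^ m) has_real_derivative
       (flat_exp (m + 2) t - real m * flat_exp (m + 1) t)) (at t)"
    proof -
      \<comment> \<open>The power rule yields the truncated exponent \<open>m - 1\<close>; small
        \<open>m\<close> are split off so that the powers can be simplified.\<close>
      consider "m = 0" | "m = 1" | j where "m = Suc (Suc j)"
        by (metis One_nat_def not0_implies_Suc)
      then show ?thesis
      proof cases
        case (3 j)
        have "t * (real j * t ^ (j - Suc 0)) = real j * t ^ j" by (cases j) auto
        then show ?thesis
          using 1 unfolding 3
          by (auto intro!: derivative_eq_intros simp: flat_exp_def field_simps power2_eq_square)
      qed (use 1 in \<open>auto intro!: derivative_eq_intros simp: flat_exp_def field_simps power2_eq_square\<close>)
    qed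
    then show ?thesis
      by (rule has_field_derivative_transform_within_open[where S = "{0<..}"])
         (use 1 in \<open>auto simp: flat_exp_def\<close>)
  next
    case 2
    have "((\<lambda>t. 0) has_real_derivative (flat_exp (m + 2) t - real m * flat_exp (m + 1) t)) (at t)"
      using 2 by (auto simp: flat_exp_def)
    then show ?thesis
      by (rule has_field_derivative_transform_within_open[where S = "{..<0}"])
         (use 2 in \<open>auto simp: flat_exp_def\<close>)
  next
    case 3
    \<comment> \<open>At the origin the difference quotient from the right is the same expression
      with exponent \<open>Suc m\<close>, so the preceding limit applies again.\<close>
    have "((\<lambda>h. flat_exp m h / h) \<longlongrightarrow> 0) (at 0)"
    proof (rule filterlim_split_at)
      have "eventually (\<lambda>h. flat_exp m h / h = 0) (at_left 0)"
        by (auto simp: eventually_at_filter flat_exp_def)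
      then show "((\<lambda>h. flat_exp m h / h) \<longlongrightarrow> 0) (at_left 0)"
        by (simp add: tendsto_eventually)
      have "eventually (\<lambda>h. exp (- (1 / h)) / h ^ Suc m = flat_exp m h / h) (at_right 0)"
        by (auto simp: eventually_at_filter flat_exp_def)
      then show "((\<lambda>h. flat_exp m h / h) \<longlongrightarrow> 0) (at_right 0)"
        using flat_exp_tendsto_0 by (rule Lim_transform_eventually[rotated])
    qed
    then show ?thesis using 3 by (simp add: DERIV_def flat_exp_def)
  qed
qed

text \<open>A syntactic class closed under directional derivatives. Membership therefore gives
  \<open>Ck k\<close> for every \<open>k\<close> by induction, and no formula for higher derivatives
  is ever needed.\<close>

inductive_set smooth_terms :: "('a::euclidean_space \<Rightarrow> real) set" where
  const: "(\<lambda>_. c) \<in> smooth_terms"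
| coord: "(\<lambda>x. x \<bullet> b) \<in> smooth_terms"
| add: "f \<in> smooth_terms \<Longrightarrow> g \<in> smooth_terms \<Longrightarrow> (\<lambda>x. f x + g x) \<in> smooth_terms"
| mult: "f \<in> smooth_terms \<Longrightarrow> g \<in> smooth_terms \<Longrightarrow> (\<lambda>x. f x * g x) \<in> smooth_terms"
| flat_exp: "f \<in> smooth_terms \<Longrightarrow> (\<lambda>x. flat_exp m (f x)) \<in> smooth_terms"

lemma smooth_terms_derivative:
  assumes "f \<in> smooth_terms"
  shows "\<exists>D. (\<forall>x. (f has_derivative D x) (at x)) \<and> (\<forall>b. (\<lambda>x. D x b) \<in> smooth_terms)"
  using assms
proof induction
  case (const c)
  show ?case by (rule exI[of _ "\<lambda>_ _. 0"]) (auto intro: smooth_terms.const)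
next
  case (coord b)
  show ?case
    by (rule exI[of _ "\<lambda>_ h. h \<bullet> b"]) (auto intro: smooth_terms.const intro!: derivative_eq_intros)
next
  case (add f g)
  then obtain D E where "\<forall>x. (f has_derivative D x) (at x)" "\<forall>b. (\<lambda>x. D x b) \<in> smooth_terms"
    "\<forall>x. (g has_derivative E x) (at x)" "\<forall>b. (\<lambda>x. E x b) \<in> smooth_terms" by blast
  then show ?case
    by (intro exI[of _ "\<lambda>x h. D x h + E x h"]) (auto intro: smooth_terms.intros has_derivative_add)
next
  case (mult f g)
  then obtain D E where "\<forall>x. (f has_derivative D x) (at x)" "\<forall>b. (\<lambda>x. D x b) \<in> smooth_terms"
    "\<forall>x. (g has_derivative E x) (at x)" "\<forall>b. (\<lambda>x. E x b) \<in> smooth_terms" by blast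
  then show ?case using mult.hyps
    by (intro exI[of _ "\<lambda>x h. f x * E x h + D x h * g x"])
       (auto intro!: smooth_terms.add smooth_terms.mult intro: has_derivative_mult)
next
  case (flat_exp f m)
  then obtain D where D: "\<forall>x. (f has_derivative D x) (at x)" "\<forall>b. (\<lambda>x. D x b) \<in> smooth_terms" by blast
  have "((\<lambda>x. flat_exp m (f x)) has_derivative
      (\<lambda>h. D x h * (flat_exp (m + 2) (f x) + (- real m) * flat_exp (m + 1) (f x)))) (at x)" for x
  proof -
    have "((\<lambda>x. flat_exp m (f x)) has_derivative
      (\<lambda>h. D x h * (flat_exp (m + 2) (f x) - real m * flat_exp (m + 1) (f x)))) (at x)"
      using D(1) by (intro DERIV_compose_FDERIV[OF DERIV_flat_exp]) auto
    then show ?thesis by simp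
  qed
  moreover have "(\<lambda>x. D x b * (flat_exp (m + 2) (f x) + (- real m) * flat_exp (m + 1) (f x))) \<in> smooth_terms" for b
    by (intro smooth_terms.mult smooth_terms.add smooth_terms.flat_exp smooth_terms.const flat_exp.hyps)
       (use D(2) in auto)
  ultimately show ?case by (intro exI conjI allI)
qed

lemma smooth_terms_Ck: "f \<in> smooth_terms \<Longrightarrow> Ck k f"
proof (induction k arbitrary: f)
  case 0
  then obtain D where "\<forall>x. (f has_derivative D x) (at x)" using smooth_terms_derivative by blast
  then show ?case
    by (auto intro!: continuous_at_imp_continuous_on intro: has_derivative_continuous)
next
  case (Suc k)
  obtain D where D: "\<forall>x. (f has_derivative D x) (at x)" "\<forall>b. (\<lambda>x. D x b) \<in> smooth_terms"
    using smooth_terms_derivative Suc.prems by blast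
  have "frechet_derivative f (at x) = D x" for x
    using D(1) frechet_derivative_at by metis
  then show ?case
    using D Suc.IH by (auto simp: differentiable_def)
qed

lemma smooth_terms_prod:
  assumes "finite A" "\<And>i. i \<in> A \<Longrightarrow> F i \<in> smooth_terms"
  shows "(\<lambda>x. \<Prod>i\<in>A. F i x) \<in> smooth_terms"
  using assms by (induction A rule: finite_induct) (auto intro: smooth_terms.intros)

text \<open>In each coordinate the argument of the flat function is positive between the two faces
  of the box and zero on them. The factor \<open>Suc n\<close> drives the values to 1 inside the box
  while the support stays the same.\<close>

definition box_bump :: "'a::euclidean_space \<Rightarrow> 'a \<Rightarrow> nat \<Rightarrow> 'a \<Rightarrow> real" where
  "box_bump a q n x = (\<Prod>b\<in>Basis. flat_exp 0 (real (Suc n) * ((x \<bullet> b - a \<bullet> b) * (q \<bullet> b - x \<bullet> b))))"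

lemma box_bump_smooth: "box_bump a q n \<in> smooth_terms"
proof -
  have "(\<lambda>x. flat_exp 0 (real (Suc n) * ((x \<bullet> b + (- (a \<bullet> b))) * (q \<bullet> b + (-1) * (x \<bullet> b))))) \<in> smooth_terms" for b
    by (intro smooth_terms.intros)
  then have "(\<lambda>x. flat_exp 0 (real (Suc n) * ((x \<bullet> b - a \<bullet> b) * (q \<bullet> b - x \<bullet> b)))) \<in> smooth_terms" for b
    by simp
  then show ?thesis
    unfolding box_bump_def[abs_def] by (intro smooth_terms_prod) auto
qed

lemma flat_exp_0_bounds: "0 \<le> flat_exp 0 t" "flat_exp 0 t \<le> 1"
  by (auto simp: flat_exp_def)

lemma box_bump_bounds: "0 \<le> box_bump a q n x" "box_bump a q n x \<le> 1"
  unfolding box_bump_def by (auto intro!: prod_nonneg prod_le_1 simp: flat_exp_0_bounds)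

text \<open>For a degenerate pair of corners both factors of a coordinate could be negative and
  their product positive. Nonemptiness of the box excludes this.\<close>

lemma box_bump_outside:
  assumes "box a q \<noteq> {}" "x \<notin> box a q"
  shows "box_bump a q n x = 0"
proof -
  from assms(2) obtain b where b: "b \<in> Basis" "x \<bullet> b \<le> a \<bullet> b \<or> q \<bullet> b \<le> x \<bullet> b"
    by (auto simp: mem_box not_less)
  have "a \<bullet> b < q \<bullet> b" using assms(1) b by (auto simp: box_ne_empty)
  then have "(x \<bullet> b - a \<bullet> b) * (q \<bullet> b - x \<bullet> b) \<le> 0"
    using b by (auto simp: mult_le_0_iff)
  then have "\<not> 0 < real (Suc n) * ((x \<bullet> b - a \<bullet> b) * (q \<bullet> b - x \<bullet> b))"
    by (metis mult_nonneg_nonpos not_less of_nat_0_le_iff)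
  then have "flat_exp 0 (real (Suc n) * ((x \<bullet> b - a \<bullet> b) * (q \<bullet> b - x \<bullet> b))) = 0"
    by (simp add: flat_exp_def)
  then show ?thesis unfolding box_bump_def using b(1) by (meson finite_Basis prod_zero)
qed

lemma box_bump_tendsto:
  assumes "box a q \<noteq> {}"
  shows "(\<lambda>n. box_bump a q n x) \<longlonglongrightarrow> indicator (box a q) x"
proof (cases "x \<in> box a q")
  case True
  have "(\<lambda>n. box_bump a q n x) \<longlonglongrightarrow> (\<Prod>b\<in>(Basis::'a set). 1)"
    unfolding box_bump_def
  proof (rule tendsto_prod)
    fix b :: 'a assume "b \<in> Basis"
    define s where "s = (x \<bullet> b - a \<bullet> b) * (q \<bullet> b - x \<bullet> b)"
    have s: "s > 0" using True \<open>b \<in> Basis\<close> by (auto simp: s_def mem_box)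
    have "(\<lambda>n. exp (- (1 / s) * (1 / real (Suc n)))) \<longlonglongrightarrow> exp (- (1 / s) * 0)"
      by (intro tendsto_intros lim_const_over_n[THEN LIMSEQ_Suc])
    moreover have "exp (- (1 / s) * (1 / real (Suc n))) = flat_exp 0 (real (Suc n) * s)" for n
      using s by (simp add: flat_exp_def zero_less_mult_iff mult.commute)
    ultimately show "(\<lambda>n. flat_exp 0 (real (Suc n) * ((x \<bullet> b - a \<bullet> b) * (q \<bullet> b - x \<bullet> b)))) \<longlonglongrightarrow> 1"
      by (simp add: s_def)
  qed
  then show ?thesis using True by simp
qed (simp add: assms box_bump_outside)

lemma box_bump_test_function:
  assumes "box a q \<noteq> {}" "cbox a q \<subseteq> \<Omega>"
  shows "box_bump a q n \<in> test_functions \<Omega>"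
proof -
  have "{x. box_bump a q n x \<noteq> 0} \<subseteq> cbox a q"
    using box_bump_outside[OF assms(1)] box_subset_cbox by blast
  then have "closure {x. box_bump a q n x \<noteq> 0} \<subseteq> cbox a q"
    by (intro closure_minimal) auto
  moreover from this have "bounded (closure {x. box_bump a q n x \<noteq> 0})"
    using bounded_subset[OF bounded_cbox] by blast
  ultimately show ?thesis
    using assms smooth_terms_Ck[OF box_bump_smooth]
    by (auto simp: test_functions_def compact_eq_bounded_closed)
qed

section \<open>Uniqueness of weak gradients\<close>

text \<open>A Dynkin argument: boxes are stable under intersection and generate the Borel sets. The
  step for complements needs the integral over the whole space, which is not a box and is obtained
  by exhaustion.\<close>

lemma AE_eq_0_if_integral_boxes_eq_0:
  fixes f :: "'a::euclidean_space \<Rightarrow> real"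
  assumes f: "integrable lborel f" and box0: "\<And>a q. (LINT x:box a q|lborel. f x) = 0"
  shows "AE x in lborel. f x = 0"
proof -
  have total: "(LINT x|lborel. f x) = 0"
  proof -
    define A where "A n = box (- (real n *\<^sub>R One)) (real n *\<^sub>R (One::'a))" for n
    have "(\<lambda>n. LINT x|lborel. indicator (A n) x *\<^sub>R f x) \<longlonglongrightarrow> (LINT x|lborel. f x)"
    proof (rule integral_dominated_convergence)
      show "integrable lborel (\<lambda>x. norm (f x))" using f by simp
      show "AE x in lborel. (\<lambda>n. indicator (A n) x *\<^sub>R f x) \<longlonglongrightarrow> f x"
      proof (rule AE_I2)
        fix x :: 'a
        have "x \<in> (\<Union>n. A n)" unfolding A_def UN_box_eq_UNIV by simp
        then obtain m where m: "x \<in> A m" by blast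
        have "x \<in> A n" if "n \<ge> m" for n
        proof -
          have "\<bar>x \<bullet> b\<bar> < real n" if "b \<in> Basis" for b
            using m \<open>n \<ge> m\<close> that unfolding A_def mem_box by force
          then show ?thesis unfolding A_def mem_box by force
        qed
        then have "eventually (\<lambda>n. indicator (A n) x *\<^sub>R f x = f x) sequentially"
          by (auto intro!: eventually_sequentiallyI[of m])
        then show "(\<lambda>n. indicator (A n) x *\<^sub>R f x) \<longlonglongrightarrow> f x" by (rule tendsto_eventually)
      qed
      show "AE x in lborel. norm (indicator (A n) x *\<^sub>R f x) \<le> norm (f x)" for n
        by (auto simp: indicator_def)
    qed (use f in \<open>auto simp: A_def\<close>)
    moreover have "(LINT x|lborel. indicator (A n) x *\<^sub>R f x) = 0" for n
      using box0 unfolding A_def set_lebesgue_integral_def .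
    ultimately show ?thesis by (simp add: LIMSEQ_const_iff)
  qed
  have int: "set_integrable lborel A f" if "A \<in> sets borel" for A
    using f that unfolding set_integrable_def by (intro integrable_mult_indicator) auto
  have "(LINT x:A|lborel. f x) = 0" if A: "A \<in> sets borel" for A
  proof -
    have "Int_stable  (range (\<lambda>(a, b). box a b :: 'a set))"
      by (auto simp: Int_stable_def box_Int_box)
    moreover have "(range (\<lambda>(a, b). box a b)) \<subseteq> Pow (UNIV :: 'a set)"
      by auto
    moreover have "A \<in> sigma_sets UNIV (range (\<lambda>(a, b). box a b))"
       using A unfolding borel_eq_box by simp
    ultimately show ?thesis
    proof (induction rule: sigma_sets_induct_disjoint)
      case (basic A) then show ?case using box0 by auto
    next
      case empty then show ?case by (simp add: set_lebesgue_integral_def)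
    next
      case (compl A)
      then have A: "A \<in> sets borel" by (simp add: borel_eq_box)
      have "(LINT x:A \<union> (UNIV - A)|lborel. f x) = (LINT x:A|lborel. f x) + (LINT x:UNIV - A|lborel. f x)"
        using A by (intro set_integral_Un int) auto
      then show ?case using compl.IH total by (simp add: set_lebesgue_integral_def)
    next
      case (union F)
      then have F: "F i \<in> sets borel" for i by (simp add: borel_eq_box subset_eq)
      have "(LINT x:(\<Union>i. F i)|lborel. f x) = (\<Sum>i. LINT x:F i|lborel. f x)"
        using F union(1) by (intro lebesgue_integral_countable_add int) (auto simp: disjoint_family_on_def)
      then show ?case using union.IH by simp
    qed
  qed
  then show ?thesis
    using f by (intro density_unique_real) (auto simp: set_lebesgue_integral_def)
qed

lemma integrable_lebesgue_on_extend:
  fixes h :: "'a::euclidean_space \<Rightarrow> 'b::euclidean_space"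
  assumes "integrable (lebesgue_on K) h" "K \<in> sets lebesgue" "\<Omega> \<in> sets lebesgue" "K \<subseteq> \<Omega>"
  shows "integrable (lebesgue_on \<Omega>) (\<lambda>x. indicator K x *\<^sub>R h x)"
proof -
  have "integrable lebesgue (\<lambda>x. indicator K x *\<^sub>R h x)"
    using assms by (subst integrable_restrict_space[symmetric]) auto
  moreover have "(\<lambda>x. indicator \<Omega> x *\<^sub>R indicator K x *\<^sub>R h x) = (\<lambda>x. indicator K x *\<^sub>R h x)"
    using assms(4) by (auto simp: indicator_def fun_eq_iff)
  ultimately show ?thesis
    using assms by (subst integrable_restrict_space) (auto simp del: scaleR_scaleR)
qed

lemma continuous_borel_measurable_lebesgue_on:
  fixes f :: "'a::euclidean_space \<Rightarrow> 'b::euclidean_space"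
  assumes "continuous_on UNIV f"
  shows "f \<in> borel_measurable (lebesgue_on S)"
proof -
  have "f \<in> borel_measurable lborel"
    using assms by (simp add: borel_measurable_continuous_onI)
  then have "f \<in> borel_measurable lebesgue" by (rule measurable_completion)
  then show ?thesis by (rule measurable_restrict_space1)
qed

text \<open>Bumps converge boundedly to the indicator of a box, so the integral of \<open>h\<close>
  vanishes over every box whose closed box lies in \<Omega>. Inside one such closed box the Dynkin
  argument gives \<open>h = 0\<close>, and countably many of them cover \<Omega>.\<close>

lemma fundamental_lemma:
  fixes h :: "'a::euclidean_space \<Rightarrow> real"
  assumes \<Omega>: "open \<Omega>"
    and int: "\<And>K. compact K \<Longrightarrow> K \<subseteq> \<Omega> \<Longrightarrow> integrable (lebesgue_on K) h"
    and 0: "\<And>\<psi>. \<psi> \<in> test_functions \<Omega> \<Longrightarrow> (LINT x|lebesgue_on \<Omega>. h x * \<psi> x) = 0"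
  shows "AE x in lebesgue_on \<Omega>. h x = 0"
proof -
  have [measurable]: "\<Omega> \<in> sets lebesgue" using \<Omega> by auto
  have box0: "(LINT x|lebesgue. indicator (box a q) x *\<^sub>R h x) = 0" if sub: "cbox a q \<subseteq> \<Omega>" for a q
  proof (cases "box a q = {}")
    case False
    \<comment> \<open>Since \<open>h\<close> is only locally integrable on \<Omega>, it is cut off
      to a compact box to obtain a dominating function; the bumps do not notice the cut.\<close>
    define h2 where "h2 x = indicator (cbox a q) x *\<^sub>R h x" for x
    have h2: "integrable (lebesgue_on \<Omega>) h2"
      unfolding h2_def by (rule integrable_lebesgue_on_extend[OF int[OF compact_cbox sub]]) (use sub in auto)
    have eq: "h x * box_bump a q n x = h2 x * box_bump a q n x" for n x
      using box_bump_outside[OF False, of x n] box_subset_cbox[of a q]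
      by (cases "x \<in> box a q") (auto simp: h2_def indicator_def)
    have m: "box_bump a q n \<in> borel_measurable (lebesgue_on \<Omega>)" for n
      using smooth_terms_Ck[OF box_bump_smooth, of 0]
      by (intro continuous_borel_measurable_lebesgue_on) simp
    have "(\<lambda>n. LINT x|lebesgue_on \<Omega>. h2 x * box_bump a q n x) \<longlonglongrightarrow>
       (LINT x|lebesgue_on \<Omega>. h2 x * indicator (box a q) x)"
    proof (rule integral_dominated_convergence)
      show "integrable (lebesgue_on \<Omega>) (\<lambda>x. norm (h2 x))" using h2 by simp
      show "AE x in lebesgue_on \<Omega>. (\<lambda>n. h2 x * box_bump a q n x) \<longlonglongrightarrow> h2 x * indicator (box a q) x"
        by (intro AE_I2 tendsto_intros box_bump_tendsto False)
      show "AE x in lebesgue_on \<Omega>. norm (h2 x * box_bump a q n x) \<le> norm (h2 x)" for n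
        by (intro AE_I2) (auto simp: abs_mult box_bump_bounds mult_left_le)
      show "(\<lambda>x. h2 x * indicator (box a q) x) \<in> borel_measurable (lebesgue_on \<Omega>)"
      proof (rule borel_measurable_times[OF borel_measurable_integrable[OF h2]])
        show "indicator (box a q) \<in> borel_measurable (lebesgue_on \<Omega>)"
          by (intro measurable_restrict_space1 borel_measurable_indicator) auto
      qed
      show "(\<lambda>x. h2 x * box_bump a q n x) \<in> borel_measurable (lebesgue_on \<Omega>)" for n
        by (rule borel_measurable_times[OF borel_measurable_integrable[OF h2] m])
    qed
    moreover have "(LINT x|lebesgue_on \<Omega>. h2 x * box_bump a q n x) = 0" for n
      using 0[OF box_bump_test_function[OF False sub]] unfolding eq .
    ultimately have "(LINT x|lebesgue_on \<Omega>. h2 x * indicator (box a q) x) = 0"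
      by (simp add: LIMSEQ_const_iff)
    moreover have "(LINT x|lebesgue_on \<Omega>. h2 x * indicator (box a q) x)
        = (LINT x|lebesgue. indicator (box a q) x *\<^sub>R h x)"
    proof -
      have "indicator \<Omega> x *\<^sub>R (h2 x * indicator (box a q) x) = indicator (box a q) x *\<^sub>R h x" for x
        using subsetD[OF sub, of x] subsetD[OF box_subset_cbox[of a q], of x]
        by (cases "x \<in> box a q") (auto simp: h2_def)
      then have eq2: "(\<lambda>x. indicator \<Omega> x *\<^sub>R (h2 x * indicator (box a q) x)) = (\<lambda>x. indicator (box a q) x *\<^sub>R h x)"
        by (rule ext)
      show ?thesis by (subst integral_restrict_space) (simp, simp only: eq2)
    qed
    ultimately show ?thesis by simp
  qed simp
  have AE_box: "AE x in lebesgue. x \<in> cbox p q \<longrightarrow> h x = 0" if sub: "cbox p q \<subseteq> \<Omega>" for p q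
  proof -
    have "integrable (lebesgue_on (cbox p q)) h" using sub by (intro int) auto
    then have "integrable lebesgue (\<lambda>x. indicator (cbox p q) x *\<^sub>R h x)"
      by (subst (asm) integrable_restrict_space) auto
    then have "integrable lebesgue (\<lambda>x. indicator (box p q) x *\<^sub>R (indicator (cbox p q) x *\<^sub>R h x))"
      by (rule integrable_mult_indicator[rotated]) auto
    moreover have "(\<lambda>x. indicator (box p q) x *\<^sub>R (indicator (cbox p q) x *\<^sub>R h x)) = (\<lambda>x. indicator (box p q) x *\<^sub>R h x)"
      using box_subset_cbox[of p q] by (auto simp: indicator_def fun_eq_iff)
    ultimately have hint: "integrable lebesgue (\<lambda>x. indicator (box p q) x *\<^sub>R h x)" by simp
    \<comment> \<open>A Borel representative, because the Dynkin argument lives on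
      \<open>lborel\<close> whereas \<open>h\<close> is merely Lebesgue measurable.\<close>
    then obtain h' where h'[measurable]: "h' \<in> borel_measurable lborel"
      and h'eq: "AE x in lborel. indicator (box p q) x *\<^sub>R h x = h' x"
      using completion_ex_borel_measurable_real[OF borel_measurable_integrable[OF hint]] by auto
    have h'eq': "AE x in lebesgue. indicator (box p q) x *\<^sub>R h x = h' x"
      using h'eq by (rule AE_completion)
    have h'l[measurable]: "h' \<in> borel_measurable lebesgue" using h' by (rule measurable_completion)
    have "integrable lebesgue h'"
      using hint integrable_cong_AE[OF borel_measurable_integrable[OF hint] h'l h'eq'] by simp
    then have "integrable lborel h'" using h' by (simp add: integrable_completion)
    moreover have "(LINT x:box a b|lborel. h' x) = 0" for a b
    proof -
      \<comment> \<open>For an arbitrary test box only its intersection with \<open>box p q\<close>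
        counts. That is again a box, with closure in \<Omega>, so the vanishing already shown
        applies.\<close>
      obtain c d where cd: "box a b \<inter> box p q = box c d" unfolding box_Int_box by blast
      have cd': "cbox c d \<subseteq> \<Omega>" if "box c d \<noteq> {}"
      proof -
        have "closure (box c d) \<subseteq> closure (box p q)" using cd by (intro closure_mono) auto
        moreover have "box p q \<noteq> {}" using that cd by auto
        ultimately show ?thesis using closure_box[OF that] closure_box[of p q] sub by auto
      qed
      have "(LINT x:box a b|lborel. h' x) = (LINT x|lebesgue. indicator (box a b) x *\<^sub>R h' x)"
        unfolding set_lebesgue_integral_def by (intro integral_completion[symmetric]) measurable
      also have "\<dots> = (LINT x|lebesgue. indicator (box a b) x *\<^sub>R indicator (box p q) x *\<^sub>R h x)"
      proof (rule integral_cong_AE)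
        show "(\<lambda>x. indicator (box a b) x *\<^sub>R indicator (box p q) x *\<^sub>R h x) \<in> borel_measurable lebesgue"
          by (rule borel_measurable_scaleR[OF borel_measurable_indicator borel_measurable_integrable[OF hint]]) simp
        show "AE x in lebesgue. indicator (box a b) x *\<^sub>R h' x = indicator (box a b) x *\<^sub>R indicator (box p q) x *\<^sub>R h x"
          using h'eq' by eventually_elim simp
        show "(\<lambda>x. indicator (box a b) x *\<^sub>R h' x) \<in> borel_measurable lebesgue"
          by (rule borel_measurable_scaleR[OF borel_measurable_indicator h'l]) simp
      qed
      also have "\<dots> = (LINT x|lebesgue. indicator (box c d) x *\<^sub>R h x)"
        unfolding cd[symmetric] by (intro Bochner_Integration.integral_cong) (auto simp: indicator_def)
      also have "\<dots> = 0" using box0[OF cd'] by (cases "box c d = {}") auto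
      finally show ?thesis .
    qed
    ultimately have "AE x in lborel. h' x = 0" by (rule AE_eq_0_if_integral_boxes_eq_0)
    then have "AE x in lebesgue. h' x = 0" by (rule AE_completion)
    \<comment> \<open>So far only the open box is covered; its boundary is negligible.\<close>
    moreover have "AE x in lebesgue. x \<notin> cbox p q - box p q"
      using negligible_frontier_interval[of p q] unfolding negligible_iff_null_sets by (rule AE_not_in)
    ultimately show ?thesis using h'eq' by eventually_elim (auto simp: indicator_def split: if_splits)
  qed
  obtain \<D> where D: "countable \<D>" "\<D> \<subseteq> Pow \<Omega>" "\<And>X. X \<in> \<D> \<Longrightarrow> \<exists>a b. X = cbox a b" "\<Union>\<D> = \<Omega>"
    using open_countable_Union_open_cbox[OF \<Omega>] by metis
  have "AE x in lebesgue. \<forall>X\<in>\<D>. x \<in> X \<longrightarrow> h x = 0"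
    unfolding AE_ball_countable[OF D(1)]
  proof
    fix X assume X: "X \<in> \<D>"
    then obtain a b where "X = cbox a b" using D by blast
    then show "AE x in lebesgue. x \<in> X \<longrightarrow> h x = 0" using AE_box[of a b] X D(2) by auto
  qed
  then have "AE x in lebesgue. x \<in> \<Omega> \<longrightarrow> h x = 0"
    by eventually_elim (use D(4) in blast)
  then show ?thesis by (subst AE_restrict_space_iff) auto
qed

lemma integrable_mult_test_function:
  fixes h :: "'a::euclidean_space \<Rightarrow> real"
  assumes \<Omega>: "open \<Omega>" and \<psi>: "\<psi> \<in> test_functions \<Omega>"
    and int: "\<And>K. compact K \<Longrightarrow> K \<subseteq> \<Omega> \<Longrightarrow> integrable (lebesgue_on K) h"
  shows "integrable (lebesgue_on \<Omega>) (\<lambda>x. h x * \<psi> x)"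
proof -
  define K where "K = closure {x. \<psi> x \<noteq> 0}"
  have K: "compact K" "K \<subseteq> \<Omega>" and c: "continuous_on UNIV \<psi>"
    using \<psi> by (auto simp: test_functions_def K_def dest: spec[of _ 0])
  have 0: "\<psi> x = 0" if "x \<notin> K" for x
    using that closure_subset[of "{x. \<psi> x \<noteq> 0}"] by (auto simp: K_def)
  have "bounded (\<psi> ` K)"
    using c K(1) by (intro compact_imp_bounded compact_continuous_image) (auto intro: continuous_on_subset)
  then obtain B where B: "\<forall>x\<in>K. norm (\<psi> x) \<le> B" by (auto simp: bounded_iff)
  have hK: "integrable (lebesgue_on \<Omega>) (\<lambda>x. indicator K x *\<^sub>R h x)"
    using K \<Omega> by (intro integrable_lebesgue_on_extend int)
      (auto simp: compact_imp_closed borel_closed)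
  have "integrable (lebesgue_on \<Omega>) (\<lambda>x. (indicator K x *\<^sub>R h x) * \<psi> x)"
  proof (rule Bochner_Integration.integrable_bound)
    show "integrable (lebesgue_on \<Omega>) (\<lambda>x. (indicator K x *\<^sub>R h x) * B)" using hK by simp
    show "(\<lambda>x. (indicator K x *\<^sub>R h x) * \<psi> x) \<in> borel_measurable (lebesgue_on \<Omega>)"
      using hK continuous_borel_measurable_lebesgue_on[OF c] by (intro borel_measurable_times) auto
    show "AE x in lebesgue_on \<Omega>. norm ((indicator K x *\<^sub>R h x) * \<psi> x) \<le> norm ((indicator K x *\<^sub>R h x) * B)"
    proof (rule AE_I2)
      fix x
      have "norm (\<psi> x) \<le> norm B" if "x \<in> K"
        using B that by fastforce
      then show "norm ((indicator K x *\<^sub>R h x) * \<psi> x) \<le> norm ((indicator K x *\<^sub>R h x) * B)"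
        by (auto simp: indicator_def abs_mult intro: mult_left_mono)
    qed
  qed
  moreover have "(\<lambda>x. (indicator K x *\<^sub>R h x) * \<psi> x) = (\<lambda>x. h x * \<psi> x)"
    using 0 by (auto simp: indicator_def fun_eq_iff)
  ultimately show ?thesis by (simp only:)
qed

text \<open>Each coordinate of the difference integrates to zero against all test functions. This
  makes the chosen \<open>weak_gradient\<close> computable up to null sets.\<close>

lemma is_weak_gradient_unique:
  fixes g g' :: "'a::euclidean_space \<Rightarrow> 'a"
  assumes \<Omega>: "open \<Omega>" and g: "is_weak_gradient \<Omega> f g" and g': "is_weak_gradient \<Omega> f g'"
  shows "AE x in lebesgue_on \<Omega>. g x = g' x"
proof -
  have "AE x in lebesgue_on \<Omega>. (g x - g' x) \<bullet> b = 0" if b: "b \<in> Basis" for b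
  proof (rule fundamental_lemma[OF \<Omega>])
    have gi: "integrable (lebesgue_on K) (\<lambda>x. g x \<bullet> b)"
      and gi': "integrable (lebesgue_on K) (\<lambda>x. g' x \<bullet> b)" if "compact K" "K \<subseteq> \<Omega>" for K
      using that g g' by (auto simp: is_weak_gradient_def)
    then show "integrable (lebesgue_on K) (\<lambda>x. (g x - g' x) \<bullet> b)" if "compact K" "K \<subseteq> \<Omega>" for K
      using that by (simp add: inner_diff_left)
    fix \<psi> assume \<psi>: "\<psi> \<in> test_functions \<Omega>"
    have "(LINT x|lebesgue_on \<Omega>. (g x \<bullet> b) * \<psi> x) = (LINT x|lebesgue_on \<Omega>. (g' x \<bullet> b) * \<psi> x)"
    proof -
      have "- (LINT x|lebesgue_on \<Omega>. (g x \<bullet> b) * \<psi> x) = - (LINT x|lebesgue_on \<Omega>. (g' x \<bullet> b) * \<psi> x)"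
        using g g' \<psi> b by (simp add: is_weak_gradient_def)
      then show ?thesis by simp
    qed
    moreover note integrable_mult_test_function[OF \<Omega> \<psi> gi] integrable_mult_test_function[OF \<Omega> \<psi> gi']
    ultimately show "(LINT x|lebesgue_on \<Omega>. ((g x - g' x) \<bullet> b) * \<psi> x) = 0"
      by (simp add: inner_diff_left left_diff_distrib)
  qed
  then have "AE x in lebesgue_on \<Omega>. \<forall>b\<in>Basis. (g x - g' x) \<bullet> b = 0"
    by (simp add: AE_ball_countable countable_finite)
  then show ?thesis
    by eventually_elim (simp add: euclidean_eq_iff[where 'a = 'a] inner_diff_left)
qed

text \<open>The source of all trial functions. A bounded domain has compact closure, so continuous
  functions are square integrable on it; uniqueness of weak gradients then expresses the energy by
  the classical gradient.\<close>

lemma C1_grad_restrict_closure: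
  fixes f :: "'a::euclidean_space \<Rightarrow> real"
  assumes f: "C1_grad f g" and \<Omega>: "open \<Omega>" "bounded \<Omega>"
  defines "F \<equiv> \<lambda>x. if x \<in> closure \<Omega> then f x else 0"
  shows "F \<in> H1C0 \<Omega>"
    and "dirichlet_energy \<Omega> F = (\<integral>\<^sup>+x\<in>\<Omega>. ennreal ((norm (g x))\<^sup>2) \<partial>lborel)"
proof -
  have Feq: "F x = f x" if "x \<in> \<Omega>" for x
    using that closure_subset[of \<Omega>] by (auto simp: F_def)
  have wg: "is_weak_gradient \<Omega> F g"
    by (rule C1_grad_is_weak_gradient[OF f \<Omega>(1) Feq])
  have cc: "compact (closure \<Omega>)" using \<Omega> by simp
  have L2: "k \<in> L2 \<Omega>" if k: "continuous_on UNIV k" for k :: "'a \<Rightarrow> 'b::euclidean_space"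
  proof -
    have "integrable (lebesgue_on (closure \<Omega>)) (\<lambda>x. (norm (k x))\<^sup>2)"
      using k cc by (intro integrable_lebesgue_on_compact continuous_intros) (auto intro: continuous_on_subset)
    then have "integrable lebesgue (\<lambda>x. indicator (closure \<Omega>) x *\<^sub>R (norm (k x))\<^sup>2)"
      by (subst (asm) integrable_restrict_space) auto
    then have "integrable lebesgue (\<lambda>x. indicator \<Omega> x *\<^sub>R indicator (closure \<Omega>) x *\<^sub>R (norm (k x))\<^sup>2)"
      by (rule integrable_mult_indicator[rotated]) (use \<Omega>(1) in auto)
    moreover have "(\<lambda>x. indicator \<Omega> x *\<^sub>R indicator (closure \<Omega>) x *\<^sub>R (norm (k x))\<^sup>2) = (\<lambda>x. indicator \<Omega> x *\<^sub>R (norm (k x))\<^sup>2)"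
      using closure_subset[of \<Omega>] by (auto simp: indicator_def fun_eq_iff)
    ultimately have "integrable (lebesgue_on \<Omega>) (\<lambda>x. (norm (k x))\<^sup>2)"
      using \<Omega>(1) by (subst integrable_restrict_space) auto
    then show ?thesis
      using continuous_borel_measurable_lebesgue_on[OF k] by (auto simp: L2_def)
  qed
  have g2: "g \<in> L2 \<Omega>" and f2: "f \<in> L2 \<Omega>"
    using C1_gradD[OF f] by (auto intro: L2)
  have "F \<in> borel_measurable (lebesgue_on \<Omega>) \<longleftrightarrow> f \<in> borel_measurable (lebesgue_on \<Omega>)"
    by (rule measurable_cong) (use Feq in auto)
  moreover have "integrable (lebesgue_on \<Omega>) (\<lambda>x. (norm (F x))\<^sup>2) \<longleftrightarrow> integrable (lebesgue_on \<Omega>) (\<lambda>x. (norm (f x))\<^sup>2)"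
    by (rule Bochner_Integration.integrable_cong) (use Feq in auto)
  ultimately have "F \<in> L2 \<Omega>" using f2 unfolding L2_def by blast
  then have "F \<in> H1 \<Omega>" using wg g2 by (auto simp: H1_def)
  moreover have "continuous_on (closure \<Omega>) F \<longleftrightarrow> continuous_on (closure \<Omega>) f"
    by (rule continuous_on_cong) (auto simp: F_def)
  ultimately show "F \<in> H1C0 \<Omega>"
    using C1_gradD(2)[OF f] by (auto simp: H1C0_def F_def)
  have "is_weak_gradient \<Omega> F (weak_gradient \<Omega> F)"
    unfolding weak_gradient_def by (rule someI[where P = "is_weak_gradient \<Omega> F", OF wg])
  then have ae: "AE x in lebesgue_on \<Omega>. weak_gradient \<Omega> F x = g x"
    using is_weak_gradient_unique[OF \<Omega>(1)] wg by blast
  have "dirichlet_energy \<Omega> F = (\<integral>\<^sup>+x. ennreal ((norm (g x))\<^sup>2) \<partial>lebesgue_on \<Omega>)"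
    unfolding dirichlet_energy_def by (rule nn_integral_cong_AE) (use ae in \<open>eventually_elim, simp\<close>)
  also have "\<dots> = (\<integral>\<^sup>+x\<in>\<Omega>. ennreal ((norm (g x))\<^sup>2) \<partial>lebesgue)"
    using \<Omega>(1) by (subst nn_integral_restrict_space) auto
  also have "\<dots> = (\<integral>\<^sup>+x\<in>\<Omega>. ennreal ((norm (g x))\<^sup>2) \<partial>lborel)"
    by (simp add: nn_integral_completion)
  finally show "dirichlet_energy \<Omega> F = (\<integral>\<^sup>+x\<in>\<Omega>. ennreal ((norm (g x))\<^sup>2) \<partial>lborel)" .
qed

section \<open>The first Neumann eigenvalue and the variance\<close>

locale neumann_problem = finite_measure \<mu> for \<mu> :: "'a::euclidean_space measure" +
  fixes \<Omega> :: "'a set"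
  assumes open_domain: "open \<Omega>" and bounded_domain: "bounded \<Omega>"
    and sets_measure: "sets \<mu> = sets (restrict_space borel (closure \<Omega>))"
begin

abbreviation mass :: real where "mass \<equiv> measure \<mu> (space \<mu>)"

lemma space_measure: "space \<mu> = closure \<Omega>"
  using sets_eq_imp_space_eq[OF sets_measure] by (simp add: space_restrict_space)

lemma borel_measurable_restrict: "f \<in> borel \<rightarrow>\<^sub>M N \<Longrightarrow> f \<in> \<mu> \<rightarrow>\<^sub>M N"
  by (subst measurable_cong_sets[OF sets_measure refl]) (rule measurable_restrict_space1)

lemma continuous_bounded_on_closure:
  fixes f :: "'a \<Rightarrow> 'b::euclidean_space"
  assumes "continuous_on UNIV f"
  obtains B where "\<And>x. x \<in> closure \<Omega> \<Longrightarrow> norm (f x) \<le> B"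
proof -
  have "bounded (f ` closure \<Omega>)"
    using assms bounded_domain
    by (intro compact_imp_bounded compact_continuous_image) (auto intro: continuous_on_subset)
  then show ?thesis using that by (auto simp: bounded_iff)
qed

lemma continuous_integrable:
  fixes f :: "'a \<Rightarrow> 'b::euclidean_space"
  assumes "continuous_on UNIV f"
  shows "integrable \<mu> f"
proof -
  obtain B where "\<And>x. x \<in> closure \<Omega> \<Longrightarrow> norm (f x) \<le> B"
    using continuous_bounded_on_closure[OF assms] by metis
  then show ?thesis
    using assms by (intro integrable_const_bound[of _ B])
      (auto simp: space_measure intro!: AE_I2 borel_measurable_restrict borel_measurable_continuous_onI)
qed

text \<open>On the span of 1 and \<open>f\<close>, the function a + b f has energy b^2 E and
  denominator b^2 V + M (a + b m)^2, with V the variance term, E the energy of \<open>f\<close> and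
  m its \<mu>-mean. Discarding the last square bounds every quotient by E / V.\<close>

lemma neumann_eigenvalue_variance_le:
  assumes f: "C1_grad f g" and mass: "mass > 0"
  shows "neumann_eigenvalue 1 \<Omega> \<mu> * ennreal ((LINT x|\<mu>. (f x)\<^sup>2) - (LINT x|\<mu>. f x)\<^sup>2 / mass)
     \<le> (\<integral>\<^sup>+x\<in>\<Omega>. ennreal ((norm (g x))\<^sup>2) \<partial>lborel)"
proof -
  define V where "V = (LINT x|\<mu>. (f x)\<^sup>2) - (LINT x|\<mu>. f x)\<^sup>2 / mass"
  define E where "E = (\<integral>\<^sup>+x\<in>\<Omega>. ennreal ((norm (g x))\<^sup>2) \<partial>lborel)"
  define \<phi> where "\<phi> a b x = (if x \<in> closure \<Omega> then a + b * f x else 0)" for a b x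
  have fc: "continuous_on UNIV f" by (rule C1_gradD(2)[OF f])
  have fi: "integrable \<mu> f" and f2i: "integrable \<mu> (\<lambda>x. (f x)\<^sup>2)"
    using fc by (auto intro!: continuous_integrable continuous_intros)
  have C1: "C1_grad (\<lambda>x. a + b * f x) (\<lambda>x. b *\<^sub>R g x)" for a b
    using C1_grad_add[OF C1_grad_const C1_grad_cmult[OF f]] by simp
  have \<phi>H: "\<phi> a b \<in> H1C0 \<Omega>" for a b
    using C1_grad_restrict_closure(1)[OF C1 open_domain bounded_domain] by (simp add: \<phi>_def[abs_def])
  have gm: "g \<in> borel_measurable borel"
    by (rule borel_measurable_continuous_onI[OF C1_gradD(3)[OF f]])
  have \<phi>E: "dirichlet_energy \<Omega> (\<phi> a b) = ennreal (b\<^sup>2) * E" for a b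
  proof -
    have "dirichlet_energy \<Omega> (\<phi> a b) = (\<integral>\<^sup>+x\<in>\<Omega>. ennreal ((norm (b *\<^sub>R g x))\<^sup>2) \<partial>lborel)"
      using C1_grad_restrict_closure(2)[OF C1 open_domain bounded_domain] by (simp add: \<phi>_def[abs_def])
    also have "\<dots> = (\<integral>\<^sup>+x. ennreal (b\<^sup>2) * (ennreal ((norm (g x))\<^sup>2) * indicator \<Omega> x) \<partial>lborel)"
      by (intro nn_integral_cong) (simp add: power_mult_distrib ennreal_mult mult.assoc)
    also have "\<dots> = ennreal (b\<^sup>2) * E"
      unfolding E_def using gm open_domain by (intro nn_integral_cmult) simp
    finally show ?thesis .
  qed
  \<comment> \<open>The square is completed in \<open>a\<close>, which exhibits the two nonnegative
    parts of the denominator.\<close>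
  have \<phi>D: "(\<integral>\<^sup>+x. ennreal ((\<phi> a b x)\<^sup>2) \<partial>\<mu>) = ennreal (b\<^sup>2 * V + mass * (a + b * (LINT x|\<mu>. f x) / mass)\<^sup>2)" for a b
  proof -
    have "(\<integral>\<^sup>+x. ennreal ((\<phi> a b x)\<^sup>2) \<partial>\<mu>) = (\<integral>\<^sup>+x. ennreal ((a + b * f x)\<^sup>2) \<partial>\<mu>)"
      by (intro nn_integral_cong) (simp add: \<phi>_def space_measure)
    also have "\<dots> = ennreal (LINT x|\<mu>. (a + b * f x)\<^sup>2)"
      using fc by (intro nn_integral_eq_integral continuous_integrable continuous_intros) auto
    also have "(LINT x|\<mu>. (a + b * f x)\<^sup>2) = (LINT x|\<mu>. a\<^sup>2 + (2 * a * b * f x + b\<^sup>2 * (f x)\<^sup>2))"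
      by (intro Bochner_Integration.integral_cong) (auto simp: power2_eq_square algebra_simps)
    also have "\<dots> = a\<^sup>2 * mass + (2 * a * b * (LINT x|\<mu>. f x) + b\<^sup>2 * (LINT x|\<mu>. (f x)\<^sup>2))"
      using fi f2i by simp
    also have "\<dots> = b\<^sup>2 * V + mass * (a + b * (LINT x|\<mu>. f x) / mass)\<^sup>2"
      using mass by (simp add: V_def power2_eq_square field_simps)
    finally show ?thesis .
  qed
  \<comment> \<open>If \<open>V\<close> is not positive, \<open>ennreal V\<close> is 0 and the claim
    is trivial. If it is positive, the denominator is nonzero unless a = b = 0; hence 1 and
    \<open>f\<close> are linearly independent on the closure and span a space of the required
    dimension 2.\<close>
  show ?thesis
  proof (cases "V > 0")
    case True
    define S where "S = fun_space.span {\<phi> 1 0, \<phi> 0 1}"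
    have S: "S = {\<phi> a b | a b. True}"
    proof -
      have lin: "u - (\<lambda>x. k * \<phi> 1 0 x) = (\<lambda>x. l * \<phi> 0 1 x) \<longleftrightarrow> u = \<phi> k l" for u k l
      proof -
        have "(\<lambda>x. k * \<phi> 1 0 x) + (\<lambda>x. l * \<phi> 0 1 x) = \<phi> k l"
          by (auto simp: \<phi>_def fun_eq_iff)
        then show ?thesis by (metis add.commute add_diff_cancel_left' diff_add_cancel)
      qed
      show ?thesis
        unfolding S_def fun_space.span_insert[of "\<phi> 1 0"] fun_space.span_singleton[of "\<phi> 0 1"]
        using lin by (auto simp: image_iff)
    qed
    have nz: "\<phi> a b = 0 \<longleftrightarrow> a = 0 \<and> b = 0" for a b
    proof
      assume "\<phi> a b = 0"
      then have "(\<integral>\<^sup>+x. ennreal ((\<phi> a b x)\<^sup>2) \<partial>\<mu>) = 0" by simp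
      then have "b\<^sup>2 * V + mass * (a + b * (LINT x|\<mu>. f x) / mass)\<^sup>2 \<le> 0"
        unfolding \<phi>D by (simp add: ennreal_eq_0_iff)
      moreover have "b\<^sup>2 * V \<ge> 0" "mass * (a + b * (LINT x|\<mu>. f x) / mass)\<^sup>2 \<ge> 0"
        using True mass by auto
      ultimately have "b\<^sup>2 * V = 0" "mass * (a + b * (LINT x|\<mu>. f x) / mass)\<^sup>2 = 0" by linarith+
      then show "a = 0 \<and> b = 0" using True mass by auto
    qed (auto simp: \<phi>_def fun_eq_iff)
    have "fun_space.independent {\<phi> 1 0, \<phi> 0 1}"
    proof -
      have "\<phi> 1 0 \<notin> range (\<lambda>l x. l * \<phi> 0 1 x)"
      proof
        assume "\<phi> 1 0 \<in> range (\<lambda>l x. l * \<phi> 0 1 x)"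
        then obtain l where "\<phi> 1 0 = (\<lambda>x. l * \<phi> 0 1 x)" by blast
        moreover have "\<phi> 1 (- l) x = \<phi> 1 0 x - l * \<phi> 0 1 x" for x by (simp add: \<phi>_def)
        ultimately have "\<phi> 1 (- l) x = 0" for x by (metis diff_self)
        then have "\<phi> 1 (- l) = 0" by (simp add: fun_eq_iff)
        then show False using nz by simp
      qed
      then show ?thesis
        using nz[of 0 1] by (simp add: fun_space.independent_insert fun_space.span_singleton)
    qed
    moreover have "\<phi> 1 0 \<noteq> \<phi> 0 1"
    proof
      assume "\<phi> 1 0 = \<phi> 0 1"
      moreover have "\<phi> 1 (- 1) x = \<phi> 1 0 x - \<phi> 0 1 x" for x by (simp add: \<phi>_def)
      ultimately have "\<phi> 1 (- 1) = 0" by (simp add: fun_eq_iff)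
      then show False using nz by simp
    qed
    ultimately have "fun_space.dim S = 1 + 1"
      unfolding S_def by (subst fun_space.dim_span_eq_card_independent) auto
    then have mem: "S \<in> {V. fun_space.subspace V \<and> V \<subseteq> H1C0 \<Omega> \<and> fun_space.dim V = 1 + 1}"
      using \<phi>H S fun_space.subspace_span[of "{\<phi> 1 0, \<phi> 0 1}", folded S_def] by blast
    have "rayleigh_quotient \<Omega> \<mu> u \<le> E * ennreal (1 / V)" if u: "u \<in> S - {0}" for u
    proof -
      obtain a b where ab: "u = \<phi> a b" using u S by blast
      define D where "D = b\<^sup>2 * V + mass * (a + b * (LINT x|\<mu>. f x) / mass)\<^sup>2"
      have D: "b\<^sup>2 * V \<le> D" "0 \<le> b\<^sup>2 * V" using mass True by (auto simp: D_def)
      have D0: "D > 0"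
      proof (cases "b = 0")
        case True
        then have "a \<noteq> 0" using u nz ab by auto
        then show ?thesis using True mass by (simp add: D_def)
      next
        case False
        then have "b\<^sup>2 * V > 0" using True by simp
        then show ?thesis using D by linarith
      qed
      have "rayleigh_quotient \<Omega> \<mu> u = ennreal (b\<^sup>2) * E / ennreal D"
        unfolding rayleigh_quotient_def ab \<phi>D \<phi>E D_def[symmetric] using D0 by (simp add: Let_def)
      also have "\<dots> = E * ennreal (b\<^sup>2 / D)"
        using D0 by (simp add: divide_ennreal_def inverse_ennreal divide_inverse ennreal_mult mult_ac)
      also have "b\<^sup>2 / D \<le> 1 / V" using D D0 True by (simp add: field_simps)
      finally show ?thesis by (meson ennreal_leI mult_left_mono zero_le)
    qed
    then have "neumann_eigenvalue 1 \<Omega> \<mu> \<le> E * ennreal (1 / V)"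
      unfolding neumann_eigenvalue_def by (intro INF_lower2[OF mem] SUP_least)
    then have "neumann_eigenvalue 1 \<Omega> \<mu> * ennreal V \<le> E * ennreal (1 / V) * ennreal V"
      by (rule mult_right_mono) simp
    also have "\<dots> = E"
      using True by (simp add: mult.assoc ennreal_mult[symmetric])
    finally show ?thesis by (simp add: V_def E_def)
  next
    case False
    then have "ennreal V = 0" by (simp add: ennreal_eq_0_iff)
    then show ?thesis unfolding V_def[symmetric] by simp
  qed
qed

end

section \<open>The inverse square on sets of given volume\<close>

text \<open>Dyadic comparison: where |x| lies between 2^-(n+1) and 2^-n, the integrand is at most
  4^(n+1), and the ball of radius 2^-n has volume at most a constant times 8^-n because the
  dimension is at least 3. Summing over whole balls instead of shells still gives a geometric series
  of ratio 1/2.\<close>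

lemma nn_integral_inverse_square_ball_finite:
  assumes "DIM('a::euclidean_space) \<ge> 3"
  shows "(\<integral>\<^sup>+x\<in>ball (0::'a) 1. ennreal (1 / (norm x)\<^sup>2) \<partial>lborel) < \<infinity>"
proof -
  define V where "V = unit_ball_vol (DIM('a))"
  have V: "V \<ge> 0" by (simp add: V_def)
  define F where "F n x = ennreal (4 ^ Suc n) * indicator (ball (0::'a) (1 / 2 ^ n)) x" for n x
  have le: "ennreal (1 / (norm x)\<^sup>2) * indicator (ball 0 1) x \<le> (\<Sum>n. F n x)" for x
  proof (cases "x \<noteq> 0 \<and> norm x < 1")
    case True
    have "\<exists>n. (1 / 2) ^ n \<le> norm x"
      using real_arch_pow_inv[of "norm x" "1 / 2"] True by (auto intro: less_imp_le)
    then have ex: "\<exists>n. 1 / 2 ^ n \<le> norm x" by (simp add: power_one_over)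
    define m where "m = (LEAST n. 1 / 2 ^ n \<le> norm x)"
    have m: "1 / 2 ^ m \<le> norm x" unfolding m_def using ex by (rule LeastI_ex)
    have "m \<noteq> 0"
    proof
      assume "m = 0"
      then show False using m True by simp
    qed
    then obtain n where n: "m = Suc n" by (cases m) auto
    have lt: "norm x < 1 / 2 ^ n"
      using not_less_Least[of n "\<lambda>n. 1 / 2 ^ n \<le> norm x"] n unfolding m_def by auto
    have "(1 / 2 ^ m)\<^sup>2 \<le> (norm x)\<^sup>2" using m by (intro power_mono) auto
    then have "1 / 4 ^ Suc n \<le> (norm x)\<^sup>2"
      by (simp add: n power2_eq_square power_divide flip: power_mult_distrib del: power_Suc)
    then have "1 / (norm x)\<^sup>2 \<le> 4 ^ Suc n"
      using True by (simp add: field_simps del: power_Suc)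
    then have "ennreal (1 / (norm x)\<^sup>2) * indicator (ball 0 1) x \<le> F n x"
      using True lt by (simp add: F_def ennreal_leI del: power_Suc)
    also have "\<dots> \<le> (\<Sum>n. F n x)"
      using sum_le_suminf[of "\<lambda>n. F n x" "{n}"] by simp
    finally show ?thesis .
  qed auto
  have "(\<integral>\<^sup>+x\<in>ball (0::'a) 1. ennreal (1 / (norm x)\<^sup>2) \<partial>lborel) \<le> (\<integral>\<^sup>+x. (\<Sum>n. F n x) \<partial>lborel)"
    by (intro nn_integral_mono le)
  also have "\<dots> = (\<Sum>n. \<integral>\<^sup>+x. F n x \<partial>lborel)"
  proof (rule nn_integral_suminf)
    fix n
    show "F n \<in> borel_measurable lborel"
      unfolding F_def[abs_def]
      by (intro borel_measurable_times_ennreal borel_measurable_const borel_measurable_indicator) simp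
  qed
  also have "\<dots> \<le> (\<Sum>n. ennreal (4 * V * (1 / 2) ^ n))"
  proof (intro suminf_le summableI)
    fix n
    have "(\<integral>\<^sup>+x. F n x \<partial>lborel) = ennreal (4 ^ Suc n) * emeasure lborel (ball (0::'a) (1 / 2 ^ n))"
      unfolding F_def by (simp add: nn_integral_cmult_indicator del: power_Suc)
    also have "\<dots> = ennreal (4 ^ Suc n * (V * (1 / 2 ^ n) ^ DIM('a)))"
      by (simp add: emeasure_ball V_def ennreal_mult'[symmetric] del: power_Suc)
    also have "\<dots> \<le> ennreal (4 * V * (1 / 2) ^ n)"
    proof (rule ennreal_leI)
      have "(1 / 2 ^ n :: real) ^ DIM('a) \<le> (1 / 2 ^ n) ^ 3"
        using assms by (intro power_decreasing) auto
      also have "(1 / 2 ^ n :: real) ^ 3 = 1 / 8 ^ n"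
      proof -
        have "(2 ^ n * 2 ^ n * 2 ^ n :: real) = (2 * 2 * 2) ^ n" by (simp only: power_mult_distrib)
        then show ?thesis by (simp add: power3_eq_cube)
      qed
      finally have "4 ^ Suc n * (V * (1 / 2 ^ n) ^ DIM('a)) \<le> 4 ^ Suc n * (V * (1 / 8 ^ n))"
        using V by (intro mult_left_mono) auto
      also have "\<dots> = 4 * V * (4 ^ n / 8 ^ n)" by simp
      also have "(4 ^ n / 8 ^ n :: real) = (1 / 2) ^ n" by (simp add: power_divide[symmetric])
      finally show "4 ^ Suc n * (V * (1 / 2 ^ n) ^ DIM('a)) \<le> 4 * V * (1 / 2) ^ n" .
    qed
    finally show "(\<integral>\<^sup>+x. F n x \<partial>lborel) \<le> ennreal (4 * V * (1 / 2) ^ n)" .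
  qed
  also have "\<dots> = ennreal (\<Sum>n. 4 * V * (1 / 2) ^ n)"
    using V by (intro suminf_ennreal2) (auto intro!: summable_mult summable_geometric)
  also have "\<dots> < \<infinity>" by simp
  finally show ?thesis .
qed

lemma nn_integral_lborel_translate:
  fixes f :: "'a::euclidean_space \<Rightarrow> ennreal"
  assumes "f \<in> borel_measurable borel"
  shows "(\<integral>\<^sup>+x. f (x - c) \<partial>lborel) = (\<integral>\<^sup>+x. f x \<partial>lborel)"
proof -
  have "(\<integral>\<^sup>+x. f x \<partial>lborel) = (\<integral>\<^sup>+x. f x \<partial>distr lborel borel ((+) (- c)))"
    by (simp add: lborel_distr_plus)
  also have "\<dots> = (\<integral>\<^sup>+x. f (- c + x) \<partial>lborel)"
    using assms by (subst nn_integral_distr) auto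
  finally show ?thesis by simp
qed

lemma nn_integral_inverse_square_ball_translate:
  fixes c :: "'a::euclidean_space"
  shows "(\<integral>\<^sup>+x\<in>ball c 1. ennreal (1 / (norm (x - c))\<^sup>2) \<partial>lborel) =
    (\<integral>\<^sup>+x\<in>ball (0::'a) 1. ennreal (1 / (norm x)\<^sup>2) \<partial>lborel)"
proof -
  have "(\<integral>\<^sup>+x\<in>ball c 1. ennreal (1 / (norm (x - c))\<^sup>2) \<partial>lborel) =
     (\<integral>\<^sup>+x. ennreal (1 / (norm (x - c))\<^sup>2) * indicator (ball 0 1) (x - c) \<partial>lborel)"
    by (intro nn_integral_cong) (auto simp: indicator_def dist_norm norm_minus_commute)
  also have "\<dots> = (\<integral>\<^sup>+x\<in>ball (0::'a) 1. ennreal (1 / (norm x)\<^sup>2) \<partial>lborel)"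
  proof (rule nn_integral_lborel_translate)
    have [measurable]: "ball (0::'a) 1 \<in> sets borel" by simp
    show "(\<lambda>x. ennreal (1 / (norm x)\<^sup>2) * indicator (ball (0::'a) 1) x) \<in> borel_measurable borel"
      by measurable
  qed
  finally show ?thesis .
qed

lemma AE_lborel_neq: "AE x in lborel. x \<noteq> (c::'a::euclidean_space)"
  using AE_not_in[OF countable_imp_null_set_lborel[of "{c}"]] by simp

text \<open>The weight equals 1 on the unit sphere about \<open>c\<close>, is at most 1 outside the
  ball and exceeds 1 almost everywhere inside. As \<open>S - B\<close> and \<open>B - S\<close> have
  equal volume, exchanging them cannot lower the integral. In the case of equality the integral of
  the excess over 1 on \<open>B - S\<close> is zero, which forces that set to be null.\<close>

lemma inverse_square_bathtub:
  fixes c :: "'a::euclidean_space"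
  assumes dim: "DIM('a) \<ge> 3" and S: "S \<in> sets borel"
    and vol: "emeasure lborel S = emeasure lborel (ball (0::'a) 1)"
  defines "I \<equiv> \<lambda>A. \<integral>\<^sup>+x\<in>A. ennreal (1 / (norm (x - c))\<^sup>2) \<partial>lborel"
  shows "I S \<le> I (ball c 1)"
    and "I S = I (ball c 1) \<Longrightarrow> sym_diff S (ball c 1) \<in> null_sets lborel"
proof -
  define B where "B = ball c 1"
  have [measurable]: "S \<in> sets borel" "B \<in> sets borel" using S by (auto simp: B_def)
  have split: "I A = I (A \<inter> C) + I (A - C)" if "A \<in> sets borel" "C \<in> sets borel" for A C
  proof -
    have "I A = (\<integral>\<^sup>+x. ennreal (1 / (norm (x - c))\<^sup>2) * indicator (A \<inter> C) x
                + ennreal (1 / (norm (x - c))\<^sup>2) * indicator (A - C) x \<partial>lborel)"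
      unfolding I_def by (intro nn_integral_cong) (auto simp: indicator_def)
    also have "\<dots> = I (A \<inter> C) + I (A - C)"
      unfolding I_def using that by (intro nn_integral_add) auto
    finally show ?thesis .
  qed
  have volB: "emeasure lborel S = emeasure lborel B"
    unfolding vol B_def by (simp add: emeasure_ball)
  have fin: "emeasure lborel (S \<inter> B) \<noteq> \<infinity>"
    using emeasure_mono[of "S \<inter> B" B lborel] emeasure_bounded_finite[of B]
    by (auto simp: B_def top_unique)
  have vol_split: "emeasure lborel A = emeasure lborel (A \<inter> C) + emeasure lborel (A - C)"
    if "A \<in> sets borel" "C \<in> sets borel" for A C :: "'a set"
    using plus_emeasure[of "A \<inter> C" lborel "A - C"] that by (simp add: Int_Diff_Un Int_Diff_disjoint)
  have "emeasure lborel (S \<inter> B) + emeasure lborel (S - B) = emeasure lborel (S \<inter> B) + emeasure lborel (B - S)"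
    using volB vol_split[OF \<open>S \<in> sets borel\<close> \<open>B \<in> sets borel\<close>] vol_split[OF \<open>B \<in> sets borel\<close> \<open>S \<in> sets borel\<close>]
    by (simp add: Int_commute)
  then have diff: "emeasure lborel (S - B) = emeasure lborel (B - S)"
    using fin by (simp add: ennreal_add_left_cancel)
  have out: "I (S - B) \<le> emeasure lborel (S - B)"
  proof -
    have "I (S - B) \<le> (\<integral>\<^sup>+x. indicator (S - B) x \<partial>lborel)"
      unfolding I_def
    proof (intro nn_integral_mono)
      fix x
      have "1 / (norm (x - c))\<^sup>2 \<le> 1" if "x \<notin> B"
      proof -
        have "1 \<le> norm (x - c)" using that by (simp add: B_def dist_norm norm_minus_commute)
        then have "1 \<le> (norm (x - c))\<^sup>2" by (rule one_le_power)
        then show ?thesis by (simp add: divide_le_eq_1)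
      qed
      then show "ennreal (1 / (norm (x - c))\<^sup>2) * indicator (S - B) x \<le> indicator (S - B) x"
        by (cases "x \<in> S - B") (simp_all add: ennreal_le_1)
    qed
    then show ?thesis by simp
  qed
  have gt: "AE x in lborel. x \<in> B \<longrightarrow> 1 / (norm (x - c))\<^sup>2 > 1"
    using AE_lborel_neq[of c]
  proof eventually_elim
    case (elim x)
    show ?case
    proof
      assume "x \<in> B"
      then have "norm (x - c) < 1" by (simp add: B_def dist_norm norm_minus_commute)
      then have "(norm (x - c))\<^sup>2 < 1" by (simp add: power_less_one_iff abs_square_less_1)
      then show "1 / (norm (x - c))\<^sup>2 > 1" using elim by simp
    qed
  qed
  have ins: "I (B - S) = emeasure lborel (B - S) + (\<integral>\<^sup>+x\<in>B - S. ennreal (1 / (norm (x - c))\<^sup>2 - 1) \<partial>lborel)"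
  proof -
    have "I (B - S) = (\<integral>\<^sup>+x. indicator (B - S) x + ennreal (1 / (norm (x - c))\<^sup>2 - 1) * indicator (B - S) x \<partial>lborel)"
      unfolding I_def
    proof (rule nn_integral_cong_AE)
      show "AE x in lborel. ennreal (1 / (norm (x - c))\<^sup>2) * indicator (B - S) x =
         indicator (B - S) x + ennreal (1 / (norm (x - c))\<^sup>2 - 1) * indicator (B - S) x"
        using gt
      proof eventually_elim
        case (elim x)
        have "ennreal h = 1 + ennreal (h - 1)" if "h > 1" for h
          using that by (simp flip: ennreal_1 ennreal_plus)
        then show ?case
          using elim by (cases "x \<in> B - S") auto
      qed
    qed
    also have "\<dots> = emeasure lborel (B - S) + (\<integral>\<^sup>+x\<in>B - S. ennreal (1 / (norm (x - c))\<^sup>2 - 1) \<partial>lborel)"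
      by (subst nn_integral_add) auto
    finally show ?thesis .
  qed
  show le: "I S \<le> I (ball c 1)"
  proof -
    have "emeasure lborel (B - S) \<le> I (B - S)" unfolding ins by simp
    then have "I (S - B) \<le> I (B - S)" using out unfolding diff by (rule order_trans[rotated])
    then show ?thesis
      unfolding split[OF \<open>S \<in> sets borel\<close> \<open>B \<in> sets borel\<close>] B_def[symmetric]
        split[OF \<open>B \<in> sets borel\<close> \<open>S \<in> sets borel\<close>]
      by (simp add: Int_commute add_left_mono)
  qed
  show "sym_diff S (ball c 1) \<in> null_sets lborel" if eq: "I S = I (ball c 1)"
  proof -
    \<comment> \<open>Finiteness is what permits cancelling the common part
      \<open>I (S \<inter> B)\<close>; it rests on the dimension bound.\<close>
    have "I B < \<infinity>"
      unfolding I_def B_def nn_integral_inverse_square_ball_translate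
      by (rule nn_integral_inverse_square_ball_finite[OF dim])
    then have If: "I (S \<inter> B) \<noteq> \<infinity>" "I (B - S) \<noteq> \<infinity>"
      using split[OF \<open>B \<in> sets borel\<close> \<open>S \<in> sets borel\<close>] by (auto simp: Int_commute)
    have "I (S \<inter> B) + I (S - B) = I (S \<inter> B) + I (B - S)"
      using eq split[OF \<open>B \<in> sets borel\<close> \<open>S \<in> sets borel\<close>] split[OF \<open>S \<in> sets borel\<close> \<open>B \<in> sets borel\<close>]
      by (simp add: Int_commute B_def)
    then have "I (S - B) = I (B - S)" using If by (simp add: ennreal_add_left_cancel)
    then have "I (B - S) \<le> emeasure lborel (B - S) + 0" using out diff by simp
    moreover have "emeasure lborel (B - S) \<noteq> \<infinity>" using ins If by auto
    ultimately have "(\<integral>\<^sup>+x\<in>B - S. ennreal (1 / (norm (x - c))\<^sup>2 - 1) \<partial>lborel) = 0"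
      unfolding ins by (simp add: ennreal_add_left_cancel_le)
    then have "AE x in lborel. ennreal (1 / (norm (x - c))\<^sup>2 - 1) * indicator (B - S) x = 0"
      by (subst (asm) nn_integral_0_iff_AE) auto
    then have "AE x in lborel. x \<notin> B - S"
      using gt by eventually_elim (auto simp: indicator_def ennreal_eq_0_iff split: if_splits)
    then have "B - S \<in> null_sets lborel" by (simp add: AE_iff_null_sets)
    moreover from this diff have "S - B \<in> null_sets lborel" by (auto simp: null_sets_def)
    ultimately show ?thesis unfolding B_def by (intro null_sets.Un)
  qed
qed

section \<open>The energy density of the equator map\<close>

lemma equator_map_derivative:
  fixes x :: "'a::euclidean_space"
  assumes "x \<noteq> 0"
  shows "(equator_map has_derivative (\<lambda>h. h /\<^sub>R norm x - ((x \<bullet> h) / norm x ^ 3) *\<^sub>R x)) (at x)"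
proof -
  have "((\<lambda>x. inverse (norm x)) has_derivative (\<lambda>h. - (inverse (norm x) * (h \<bullet> sgn x) * inverse (norm x)))) (at x)"
    by (rule Deriv.has_derivative_inverse[OF _ has_derivative_norm[OF assms]]) (use assms in simp)
  then have "((\<lambda>x. x /\<^sub>R norm x) has_derivative (\<lambda>h. h /\<^sub>R norm x +
      (- (inverse (norm x) * (h \<bullet> sgn x) * inverse (norm x))) *\<^sub>R x)) (at x)"
    by (rule has_derivative_scaleR[OF _ has_derivative_ident])
  moreover have "(\<lambda>h. h /\<^sub>R norm x + (- (inverse (norm x) * (h \<bullet> sgn x) * inverse (norm x))) *\<^sub>R x) =
      (\<lambda>h. h /\<^sub>R norm x - ((x \<bullet> h) / norm x ^ 3) *\<^sub>R x)"
  proof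
    fix h
    have "h \<bullet> sgn x = (x \<bullet> h) / norm x"
      by (simp add: sgn_div_norm inner_commute[of h] divide_inverse)
    then have "inverse (norm x) * (h \<bullet> sgn x) * inverse (norm x) = (x \<bullet> h) / norm x ^ 3"
      by (simp add: power3_eq_cube divide_inverse)
    then show "h /\<^sub>R norm x + (- (inverse (norm x) * (h \<bullet> sgn x) * inverse (norm x))) *\<^sub>R x =
      h /\<^sub>R norm x - ((x \<bullet> h) / norm x ^ 3) *\<^sub>R x"
      by (simp only: scaleR_minus_left diff_conv_add_uminus)
  qed
  ultimately show ?thesis unfolding equator_map_def[abs_def] by (rule has_derivative_eq_rhs)
qed

text \<open>The differential at x is 1 / |x| times the orthogonal projection onto the complement of
  x, and such a projection has squared Hilbert--Schmidt norm d - 1.\<close>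

lemma equator_energy_eq:
  "equator_energy TYPE('a::euclidean_space) =
     (\<integral>\<^sup>+x\<in>ball (0::'a) 1. ennreal (real (DIM('a) - 1) * (1 / (norm x)\<^sup>2)) \<partial>lborel)"
  unfolding equator_energy_def
proof (rule nn_integral_cong_AE)
  show "AE x in lborel. ennreal (\<Sum>b\<in>Basis. (norm (frechet_derivative equator_map (at x) b))\<^sup>2) *
        indicator (ball (0::'a) 1) x =
      ennreal (real (DIM('a) - 1) * (1 / (norm x)\<^sup>2)) * indicator (ball 0 1) x"
    using AE_lborel_neq[of "0::'a"]
  proof eventually_elim
    case (elim x)
    define r where "r = norm x"
    have r: "r > 0" using elim by (simp add: r_def)
    have rr: "x \<bullet> x = r\<^sup>2" by (simp add: r_def power2_norm_eq_inner)
    have eq: "(norm (frechet_derivative equator_map (at x) b))\<^sup>2 = 1 / r\<^sup>2 - (x \<bullet> b)\<^sup>2 / r ^ 4" if "b \<in> Basis" for b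
    proof -
      define k where "k = (x \<bullet> b) / r ^ 3"
      have "frechet_derivative equator_map (at x) b = (1 / r) *\<^sub>R b - k *\<^sub>R x"
        using frechet_derivative_at[OF equator_map_derivative[OF elim]] unfolding r_def k_def
        by (simp add: divide_inverse fun_eq_iff)
      moreover have "(norm ((1 / r) *\<^sub>R b - k *\<^sub>R x))\<^sup>2 =
         (1 / r)\<^sup>2 - 2 * ((1 / r) * k) * (x \<bullet> b) + k\<^sup>2 * r\<^sup>2"
        unfolding rr[symmetric] power2_norm_eq_inner using that
        by (simp add: inner_diff_left inner_diff_right inner_commute power2_eq_square algebra_simps)
      ultimately have "(norm (frechet_derivative equator_map (at x) b))\<^sup>2 =
         (1 / r)\<^sup>2 - 2 * ((1 / r) * k) * (x \<bullet> b) + k\<^sup>2 * r\<^sup>2"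
        by (simp only:)
      also have "\<dots> = 1 / r\<^sup>2 - (x \<bullet> b)\<^sup>2 / r ^ 4"
      proof -
        have "(1 / r) * k * (x \<bullet> b) = (x \<bullet> b)\<^sup>2 / r ^ 4" "k\<^sup>2 * r\<^sup>2 = (x \<bullet> b)\<^sup>2 / r ^ 4"
          using r by (simp_all add: k_def power2_eq_square power3_eq_cube power4_eq_xxxx)
        then show ?thesis by (simp add: power_divide)
      qed
      finally show ?thesis .
    qed
    have "(\<Sum>b\<in>Basis. (norm (frechet_derivative equator_map (at x) b))\<^sup>2) = (\<Sum>b\<in>Basis. 1 / r\<^sup>2 - (x \<bullet> b)\<^sup>2 / r ^ 4)"
      by (intro sum.cong eq) auto
    also have "\<dots> = real DIM('a) / r\<^sup>2 - (\<Sum>b\<in>Basis. (x \<bullet> b)\<^sup>2) / r ^ 4"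
      by (simp add: sum_subtractf sum_divide_distrib)
    also have "(\<Sum>b\<in>Basis. (x \<bullet> b)\<^sup>2) = r\<^sup>2"
      unfolding rr[symmetric] by (subst euclidean_inner) (simp add: power2_eq_square)
    also have "real DIM('a) / r\<^sup>2 - r\<^sup>2 / r ^ 4 = real (DIM('a) - 1) * (1 / r\<^sup>2)"
    proof -
      have "r\<^sup>2 / r ^ 4 = 1 / r\<^sup>2" using r by (simp add: power2_eq_square power4_eq_xxxx)
      then show ?thesis
        by (simp add: of_nat_diff DIM_positive Suc_leI left_diff_distrib diff_divide_distrib)
    qed
    finally show ?case by (simp add: r_def)
  qed
qed

section \<open>The geometric median and the regularised equator map\<close>

text \<open>Near \<open>c\<close> the integral over a unit ball is an upper bound; farther away the
  weight is at most 1 and a bounded set has finite volume. The position of \<open>c\<close> relative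
  to \<open>S\<close> is arbitrary.\<close>

lemma nn_integral_inverse_square_finite:
  fixes c :: "'a::euclidean_space"
  assumes dim: "DIM('a) \<ge> 3" and S: "S \<in> sets borel" "bounded S"
  shows "(\<integral>\<^sup>+x\<in>S. ennreal (1 / (norm (x - c))\<^sup>2) \<partial>lborel) < \<infinity>"
proof -
  have [measurable]: "S \<in> sets borel" "ball c 1 \<in> sets borel" using S by auto
  have "(\<integral>\<^sup>+x\<in>S. ennreal (1 / (norm (x - c))\<^sup>2) \<partial>lborel) \<le>
     (\<integral>\<^sup>+x. ennreal (1 / (norm (x - c))\<^sup>2) * indicator (ball c 1) x + indicator S x \<partial>lborel)"
  proof (rule nn_integral_mono)
    fix x
    show "ennreal (1 / (norm (x - c))\<^sup>2) * indicator S x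
      \<le> ennreal (1 / (norm (x - c))\<^sup>2) * indicator (ball c 1) x + indicator S x"
    proof (cases "x \<in> S - ball c 1")
      case True
      then have "1 \<le> norm (x - c)" by (simp add: dist_norm norm_minus_commute)
      then have "1 \<le> (norm (x - c))\<^sup>2" by (rule one_le_power)
      then have "1 / (norm (x - c))\<^sup>2 \<le> 1" by (simp add: divide_le_eq_1)
      then show ?thesis using True by (simp add: ennreal_le_1)
    next
      case False
      then show ?thesis by (cases "x \<in> S") auto
    qed
  qed
  also have "\<dots> = (\<integral>\<^sup>+x\<in>ball c 1. ennreal (1 / (norm (x - c))\<^sup>2) \<partial>lborel) + emeasure lborel S"
    by (subst nn_integral_add) auto
  also have "\<dots> < \<infinity>"
    using nn_integral_inverse_square_ball_finite[OF dim] emeasure_bounded_finite[OF S(2)]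
    by (simp add: nn_integral_inverse_square_ball_translate)
  finally show ?thesis .
qed

lemma set_integrable_inverse_square:
  fixes c :: "'a::euclidean_space"
  assumes dim: "DIM('a) \<ge> 3" and S: "S \<in> sets borel" "bounded S"
  shows "set_integrable lborel S (\<lambda>x. 1 / (norm (x - c))\<^sup>2)"
  unfolding set_integrable_def
proof (rule integrableI_bounded)
  have "(\<integral>\<^sup>+x. ennreal (norm (indicator S x *\<^sub>R (1 / (norm (x - c))\<^sup>2))) \<partial>lborel) =
     (\<integral>\<^sup>+x\<in>S. ennreal (1 / (norm (x - c))\<^sup>2) \<partial>lborel)"
    by (intro nn_integral_cong) (auto simp: indicator_def)
  then show "(\<integral>\<^sup>+x. ennreal (norm (indicator S x *\<^sub>R (1 / (norm (x - c))\<^sup>2))) \<partial>lborel) < \<infinity>"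
    using nn_integral_inverse_square_finite[OF assms] by simp
qed (use S in auto)

text \<open>The factor \<open>l\<close>, later the eigenvalue, could a priori be infinite, and
  multiplication by infinity is not continuous at 0. For \<open>A > 0\<close> a single bound with
  \<open>a n > 0\<close> already makes \<open>l\<close> finite; otherwise the left-hand side is
  0.\<close>

lemma ennreal_mult_le_limit:
  fixes a r :: "nat \<Rightarrow> real"
  assumes le: "\<And>n. l * ennreal (a n) \<le> ennreal (r n)"
    and a: "a \<longlonglongrightarrow> A" and r: "r \<longlonglongrightarrow> R"
  shows "l * ennreal A \<le> ennreal R"
proof (cases "A > 0")
  case True
  have "l < top"
  proof (rule ccontr)
    assume "\<not> l < top"
    then have "l = top" by (simp add: less_top[symmetric])
    moreover obtain n where "a n > 0"
      using order_tendstoD(1)[OF a True] by (auto simp: eventually_sequentially)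
    ultimately have "top \<le> ennreal (r n)"
      using le[of n] by (simp add: ennreal_top_mult ennreal_eq_0_iff not_le)
    then show False by (simp add: top_unique)
  qed
  then have "(\<lambda>n. l * ennreal (a n)) \<longlonglongrightarrow> l * ennreal A"
    using a by (intro ennreal_tendsto_cmult tendsto_ennrealI)
  moreover have "(\<lambda>n. ennreal (r n)) \<longlonglongrightarrow> ennreal R" using r by (rule tendsto_ennrealI)
  ultimately show ?thesis using le by (intro LIMSEQ_le) auto
next
  case False
  then have "ennreal A = 0" by (simp add: ennreal_eq_0_iff)
  then show ?thesis by simp
qed

text \<open>Only an inequality, because \<open>ennreal\<close> sends negative summands to 0. It
  allows the coordinate variances to be added without first checking their signs.\<close>

lemma ennreal_sum_le:
  assumes "finite I"
  shows "ennreal (\<Sum>i\<in>I. f i) \<le> (\<Sum>i\<in>I. ennreal (f i))"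
proof -
  have "ennreal (\<Sum>i\<in>I. f i) \<le> ennreal (\<Sum>i\<in>I. max 0 (f i))"
    by (intro ennreal_leI sum_mono) simp
  also have "\<dots> = (\<Sum>i\<in>I. ennreal (max 0 (f i)))" by (rule sum_ennreal[symmetric]) simp
  also have "\<dots> = (\<Sum>i\<in>I. ennreal (f i))"
    by (intro sum.cong refl) (simp add: max_def ennreal_neg)
  finally show ?thesis .
qed

text \<open>A positive \<open>e\<close> keeps the denominator away from zero, also at
  \<open>c\<close>. The gradient has the form of the singular one with |x - c| replaced by
  \<open>s x\<close>, so its pointwise limit can be read off.\<close>

lemma C1_grad_regularised_coordinate:
  fixes c :: "'a::euclidean_space"
  assumes e: "e > 0"
  defines "s \<equiv> \<lambda>x. sqrt ((norm (x - c))\<^sup>2 + e\<^sup>2)"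
  shows "C1_grad (\<lambda>x. ((x - c) \<bullet> i) / s x) (\<lambda>x. (1 / s x) *\<^sub>R i - (((x - c) \<bullet> i) / s x ^ 3) *\<^sub>R (x - c))"
proof -
  have pos: "(norm (x - c))\<^sup>2 + e\<^sup>2 > 0" for x
    using e by (simp add: add_nonneg_pos)
  then have s0: "s x > 0" for x by (simp add: s_def)
  have s_eq: "s = (\<lambda>x. sqrt ((x - c) \<bullet> (x - c) + e\<^sup>2))"
    by (simp add: s_def power2_norm_eq_inner)
  have "((\<lambda>x. ((x - c) \<bullet> i) / s x) has_derivative
     (\<lambda>h. ((1 / s x) *\<^sub>R i - (((x - c) \<bullet> i) / s x ^ 3) *\<^sub>R (x - c)) \<bullet> h)) (at x)" for x
  proof -
    have "((\<lambda>x. (x - c) \<bullet> (x - c) + e\<^sup>2) has_derivative (\<lambda>h. 2 * ((x - c) \<bullet> h))) (at x)"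
      by (auto intro!: derivative_eq_intros simp: fun_eq_iff inner_commute)
    then have *: "((\<lambda>x. sqrt ((x - c) \<bullet> (x - c) + e\<^sup>2)) has_derivative
        (\<lambda>h. (2 * ((x - c) \<bullet> h)) * (inverse (sqrt ((x - c) \<bullet> (x - c) + e\<^sup>2)) / 2))) (at x)"
      using pos[of x] by (intro DERIV_compose_FDERIV DERIV_real_sqrt) (simp_all add: power2_norm_eq_inner)
    have ds: "(s has_derivative (\<lambda>h. ((x - c) \<bullet> h) / s x)) (at x)"
    proof -
      have alg: "(2 * q) * (inverse S / 2) = q / S" for q S :: real by (simp add: inverse_eq_divide)
      show ?thesis using * unfolding s_eq alg .
    qed
    have "((\<lambda>x. x - c) has_derivative (\<lambda>h. h)) (at x)"
      by (auto intro!: derivative_eq_intros)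
    then have dn: "((\<lambda>x. (x - c) \<bullet> i) has_derivative (\<lambda>h. h \<bullet> i)) (at x)"
      by (rule has_derivative_inner_left)
    show ?thesis
    proof (rule has_derivative_eq_rhs[OF has_derivative_divide[OF dn ds]])
      show "s x \<noteq> 0" using s0[of x] by simp
      show "(\<lambda>h. - ((x - c) \<bullet> i) * (inverse (s x) * ((x - c) \<bullet> h / s x) * inverse (s x)) + (h \<bullet> i) / s x) =
        (\<lambda>h. ((1 / s x) *\<^sub>R i - (((x - c) \<bullet> i) / s x ^ 3) *\<^sub>R (x - c)) \<bullet> h)"
      proof
        fix h
        have alg: "- p * (inverse S * (q / S) * inverse S) + k / S = (1 / S) * k - (p / S ^ 3) * q"
          if "S \<noteq> 0" for p q k S :: real
          using that by (simp add: field_simps power3_eq_cube)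
        show "- ((x - c) \<bullet> i) * (inverse (s x) * ((x - c) \<bullet> h / s x) * inverse (s x)) + (h \<bullet> i) / s x =
            ((1 / s x) *\<^sub>R i - (((x - c) \<bullet> i) / s x ^ 3) *\<^sub>R (x - c)) \<bullet> h"
          unfolding inner_diff_left[of "(1 / s x) *\<^sub>R i"] inner_scaleR_left inner_commute[of i h]
          using s0[of x] by (intro alg) simp
      qed
    qed
  qed
  moreover have "continuous_on UNIV (\<lambda>x. (1 / s x) *\<^sub>R i - (((x - c) \<bullet> i) / s x ^ 3) *\<^sub>R (x - c))"
  proof -
    have "continuous_on UNIV s" unfolding s_def by (intro continuous_intros)
    moreover have "s x \<noteq> 0" "s x ^ 3 \<noteq> 0" for x using s0[of x] by simp_all
    ultimately show ?thesis by (intro continuous_intros) simp_all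
  qed
  ultimately show ?thesis unfolding C1_grad_def by blast
qed

text \<open>The left-hand side is \<open>\<Sum>\<^sub>i |\<nabla>(w u\<^sub>i)|\<^sup>2\<close> for \<open>u = y / |y|\<close>. The cross terms cancel because
  \<open>|u|\<^sup>2\<close> is constant.\<close>

lemma sum_norm_weighted_equator_gradient:
  fixes y g :: "'a::euclidean_space" and w :: real
  assumes y: "y \<noteq> 0"
  defines "r \<equiv> norm y"
  shows "(\<Sum>i\<in>Basis. (norm (w *\<^sub>R ((1 / r) *\<^sub>R i - ((y \<bullet> i) / r ^ 3) *\<^sub>R y) + ((y \<bullet> i) / r) *\<^sub>R g))\<^sup>2) =
     w\<^sup>2 * (real (DIM('a) - 1) * (1 / r\<^sup>2)) + (norm g)\<^sup>2"
proof -
  have r: "r > 0" using y by (simp add: r_def)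
  \<comment> \<open>Each summand is the squared norm of
    \<open>\<alpha> *\<^sub>R i + (y \<bullet> i) *\<^sub>R z\<close> with the same \<open>z\<close>
    for all \<open>i\<close>. Summation over the basis then leaves only \<open>y \<bullet> z\<close>
    and the norms of \<open>y\<close> and \<open>z\<close>.\<close>
  define \<alpha> where "\<alpha> = w / r"
  define z where "z = (1 / r) *\<^sub>R g - (w / r ^ 3) *\<^sub>R y"
  have yy: "y \<bullet> y = r\<^sup>2" by (simp add: r_def power2_norm_eq_inner)
  have "(norm (w *\<^sub>R ((1 / r) *\<^sub>R i - ((y \<bullet> i) / r ^ 3) *\<^sub>R y) + ((y \<bullet> i) / r) *\<^sub>R g))\<^sup>2 =
      \<alpha>\<^sup>2 + 2 * \<alpha> * ((y \<bullet> i) * (z \<bullet> i)) + (y \<bullet> i)\<^sup>2 * (z \<bullet> z)" if i: "i \<in> Basis" for i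
  proof -
    have eq: "w *\<^sub>R ((1 / r) *\<^sub>R i - ((y \<bullet> i) / r ^ 3) *\<^sub>R y) + ((y \<bullet> i) / r) *\<^sub>R g = \<alpha> *\<^sub>R i + (y \<bullet> i) *\<^sub>R z"
      by (simp add: \<alpha>_def z_def scaleR_diff_right algebra_simps)
    show ?thesis
      unfolding eq power2_norm_eq_inner using i
      by (simp add: inner_add_left inner_add_right inner_commute power2_eq_square algebra_simps)
  qed
  then have "(\<Sum>i\<in>Basis. (norm (w *\<^sub>R ((1 / r) *\<^sub>R i - ((y \<bullet> i) / r ^ 3) *\<^sub>R y) + ((y \<bullet> i) / r) *\<^sub>R g))\<^sup>2) =
      (\<Sum>i\<in>Basis. \<alpha>\<^sup>2 + 2 * \<alpha> * ((y \<bullet> i) * (z \<bullet> i)) + (y \<bullet> i)\<^sup>2 * (z \<bullet> z))"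
    by (intro sum.cong) auto
  also have "\<dots> = real DIM('a) * \<alpha>\<^sup>2 + 2 * \<alpha> * (\<Sum>i\<in>Basis. (y \<bullet> i) * (z \<bullet> i)) + (\<Sum>i\<in>Basis. (y \<bullet> i)\<^sup>2) * (z \<bullet> z)"
    by (simp add: sum.distrib sum_distrib_left sum_distrib_right)
  also have "(\<Sum>i\<in>Basis. (y \<bullet> i) * (z \<bullet> i)) = y \<bullet> z" by (rule euclidean_inner[symmetric])
  also have "(\<Sum>i\<in>Basis. (y \<bullet> i)\<^sup>2) = r\<^sup>2"
    unfolding yy[symmetric] by (subst euclidean_inner) (simp add: power2_eq_square)
  also have "y \<bullet> z = (y \<bullet> g) / r - w / r"
    using r by (simp add: z_def inner_diff_right yy power2_eq_square power3_eq_cube)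
  also have "z \<bullet> z = (g \<bullet> g) / r\<^sup>2 - 2 * w * (y \<bullet> g) / r ^ 4 + w\<^sup>2 / r ^ 4"
  proof -
    have "z \<bullet> z = (1 / r) * (1 / r) * (g \<bullet> g) - 2 * ((1 / r) * (w / r ^ 3)) * (y \<bullet> g) + (w / r ^ 3) * (w / r ^ 3) * r\<^sup>2"
      unfolding z_def yy[symmetric] by (simp add: inner_diff_left inner_diff_right inner_commute algebra_simps)
    then show ?thesis using r by (simp add: power2_eq_square power3_eq_cube power4_eq_xxxx mult_ac)
  qed
  also have "real DIM('a) * \<alpha>\<^sup>2 + 2 * \<alpha> * ((y \<bullet> g) / r - w / r) +
      r\<^sup>2 * ((g \<bullet> g) / r\<^sup>2 - 2 * w * (y \<bullet> g) / r ^ 4 + w\<^sup>2 / r ^ 4) = (real DIM('a) - 1) * (w\<^sup>2 / r\<^sup>2) + g \<bullet> g"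
  proof -
    have "r\<^sup>2 * ((g \<bullet> g) / r\<^sup>2 - 2 * w * (y \<bullet> g) / r ^ 4 + w\<^sup>2 / r ^ 4) = (g \<bullet> g) - 2 * w * (y \<bullet> g) / r\<^sup>2 + w\<^sup>2 / r\<^sup>2"
      using r by (simp add: distrib_left right_diff_distrib power2_eq_square power4_eq_xxxx)
    moreover have "2 * \<alpha> * ((y \<bullet> g) / r - w / r) = 2 * w * (y \<bullet> g) / r\<^sup>2 - 2 * (w\<^sup>2 / r\<^sup>2)"
      by (simp add: \<alpha>_def right_diff_distrib power2_eq_square)
    moreover have "\<alpha>\<^sup>2 = w\<^sup>2 / r\<^sup>2" by (simp add: \<alpha>_def power_divide)
    ultimately show ?thesis by (simp add: left_diff_distrib diff_divide_distrib)
  qed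
  finally show ?thesis
    by (simp add: power2_norm_eq_inner of_nat_diff DIM_positive Suc_leI)
qed

locale nonatomic_neumann_problem = neumann_problem +
  assumes nonatomic_measure: "nonatomic \<mu>"
begin

text \<open>The point where the absence of atoms enters: the singularity of x / |x|, wherever it is
  placed, is invisible to \<mu>.\<close>

lemma AE_measure_neq: "AE x in \<mu>. x \<noteq> c"
proof (cases "c \<in> space \<mu>")
  case True
  have "{c} \<in> sets \<mu>"
    using True unfolding sets_measure space_measure by (auto simp: sets_restrict_space image_iff intro!: bexI[of _ "{c}"])
  then have "{c} \<in> null_sets \<mu>"
    using True nonatomic_measure by (auto simp: nonatomic_def)
  then show ?thesis using AE_not_in by force
qed (auto intro: AE_I2)

text \<open>At a minimiser it is enough to move in one direction, that of the mean m of
  \<open>sgn (x - c)\<close> itself. The one-sided derivative there is -|m|^2 and must be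
  nonnegative.\<close>

lemma geometric_median:
  assumes mass: "mass > 0"
  obtains c where "(LINT x|\<mu>. sgn (x - c)) = 0"
proof -
  define f where "f c = (LINT x|\<mu>. norm (x - c))" for c
  have int: "integrable \<mu> (\<lambda>x. norm (x - c))" for c
    by (intro continuous_integrable continuous_intros)
  obtain R where R: "\<And>x. x \<in> closure \<Omega> \<Longrightarrow> norm x \<le> R"
    using continuous_bounded_on_closure[OF continuous_on_id] by blast
  have "space \<mu> \<noteq> {}" using mass by auto
  then obtain x0 where "x0 \<in> space \<mu>" by blast
  then have "x0 \<in> closure \<Omega>" by (simp add: space_measure)
  then have R0: "R \<ge> 0" using R[of x0] norm_ge_zero[of x0] by linarith
  have "mass-lipschitz_on UNIV f"
  proof (rule lipschitz_onI)
    fix a b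
    have "\<bar>f a - f b\<bar> = norm (LINT x|\<mu>. norm (x - a) - norm (x - b))"
      unfolding f_def using int by (subst Bochner_Integration.integral_diff) auto
    also have "\<dots> \<le> (LINT x|\<mu>. norm (norm (x - a) - norm (x - b)))" by (rule integral_norm_bound)
    also have "\<dots> \<le> (LINT x|\<mu>. norm (a - b))"
    proof (rule integral_mono)
      show "norm (norm (x - a) - norm (x - b)) \<le> norm (a - b)" for x
        using norm_triangle_ineq3[of "x - a" "x - b"] by (simp add: norm_minus_commute)
    qed (use int in auto)
    finally show "dist (f a) (f b) \<le> mass * dist a b" by (simp add: dist_norm)
  qed (use mass in simp)
  then have cont: "continuous_on (cball 0 (2 * R)) f"
    by (rule continuous_on_subset[OF lipschitz_on_continuous_on]) simp
  obtain c where c: "c \<in> cball 0 (2 * R)" "\<And>b. b \<in> cball 0 (2 * R) \<Longrightarrow> f c \<le> f b"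
    using continuous_attains_inf[OF compact_cball _ cont] R0 by auto
  \<comment> \<open>If |b| > 2R, every x in the closure satisfies |x - b| \<ge> R \<ge> |x|, so
    \<open>b\<close> is no better than 0. The minimum over the ball of radius 2R is therefore
    global.\<close>
  have min: "f c \<le> f b" for b
  proof (cases "b \<in> cball 0 (2 * R)")
    case False
    have "f c \<le> f 0" using c R0 by auto
    also have "f 0 \<le> (LINT x|\<mu>. R)"
      unfolding f_def using int[of 0] R by (intro integral_mono) (auto simp: space_measure)
    also have "\<dots> \<le> (LINT x|\<mu>. norm (x - b))"
    proof (rule integral_mono)
      show "R \<le> norm (x - b)" if "x \<in> space \<mu>" for x
        using R[of x] that False norm_triangle_ineq2[of b x] by (simp add: space_measure norm_minus_commute)
    qed (use int in auto)
    finally show ?thesis by (simp add: f_def)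
  qed (use c in auto)
  have sgn_int: "integrable \<mu> (\<lambda>x. sgn (x - c))"
  proof (rule integrable_const_bound[of _ 1])
    show "(\<lambda>x. sgn (x - c)) \<in> borel_measurable \<mu>"
      unfolding sgn_div_norm by (intro borel_measurable_restrict) measurable
  qed (auto simp: norm_sgn)
  define m where "m = (LINT x|\<mu>. sgn (x - c))"
  define t where "t n = 1 / real (Suc n)" for n
  have t: "t n > 0" for n by (auto simp: t_def)
  have tlim: "t \<longlonglongrightarrow> 0" unfolding t_def by (rule lim_const_over_n[THEN LIMSEQ_Suc])
  have "(\<lambda>n. LINT x|\<mu>. (norm (x - (c + t n *\<^sub>R m)) - norm (x - c)) / t n) \<longlonglongrightarrow>
      (LINT x|\<mu>. - (m \<bullet> sgn (x - c)))"
  proof (rule integral_dominated_convergence)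
    show "integrable \<mu> (\<lambda>x. norm m)" by simp
    show "(\<lambda>x. - (m \<bullet> sgn (x - c))) \<in> borel_measurable \<mu>"
      using sgn_int by auto
    show "(\<lambda>x. (norm (x - (c + t n *\<^sub>R m)) - norm (x - c)) / t n) \<in> borel_measurable \<mu>" for n
      by (intro borel_measurable_restrict) measurable
    show "AE x in \<mu>. norm ((norm (x - (c + t n *\<^sub>R m)) - norm (x - c)) / t n) \<le> norm m" for n
    proof (rule AE_I2)
      fix x
      have "\<bar>norm (x - (c + t n *\<^sub>R m)) - norm (x - c)\<bar> \<le> t n * norm m"
        using norm_triangle_ineq3[of "x - (c + t n *\<^sub>R m)" "x - c"] t[of n] by simp
      then show "norm ((norm (x - (c + t n *\<^sub>R m)) - norm (x - c)) / t n) \<le> norm m"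
        using t[of n] by (simp add: pos_divide_le_eq mult.commute)
    qed
    show "AE x in \<mu>. (\<lambda>n. (norm (x - (c + t n *\<^sub>R m)) - norm (x - c)) / t n) \<longlonglongrightarrow> - (m \<bullet> sgn (x - c))"
      using AE_measure_neq[of c]
    proof eventually_elim
      case (elim x)
      have "((\<lambda>s. norm (x - c - s *\<^sub>R m)) has_derivative (\<lambda>s. (- (s *\<^sub>R m)) \<bullet> sgn (x - c))) (at 0)"
        by (rule has_derivative_compose[of "\<lambda>s. x - c - s *\<^sub>R m" "\<lambda>s. - (s *\<^sub>R m)" 0 UNIV norm])
           (use has_derivative_norm[of "x - c"] elim in \<open>auto intro!: derivative_eq_intros\<close>)
      then have "((\<lambda>s. norm (x - c - s *\<^sub>R m)) has_field_derivative - (m \<bullet> sgn (x - c))) (at 0)"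
        unfolding has_field_derivative_def by (rule has_derivative_eq_rhs) (simp add: fun_eq_iff)
      then have "((\<lambda>h. (norm (x - c - h *\<^sub>R m) - norm (x - c)) / h) \<longlongrightarrow> - (m \<bullet> sgn (x - c))) (at 0)"
        by (simp add: DERIV_def)
      moreover have "filterlim t (at 0) sequentially"
        using tlim t by (auto simp: filterlim_at intro!: always_eventually) (metis less_irrefl)
      ultimately have "(\<lambda>n. (norm (x - c - t n *\<^sub>R m) - norm (x - c)) / t n) \<longlonglongrightarrow> - (m \<bullet> sgn (x - c))"
        using filterlim_compose by blast
      then show ?case by (simp add: diff_diff_eq)
    qed
  qed
  moreover have "(LINT x|\<mu>. (norm (x - (c + t n *\<^sub>R m)) - norm (x - c)) / t n) \<ge> 0" for n
    using min[of "c + t n *\<^sub>R m"] int t[of n] by (simp add: f_def)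
  ultimately have "(LINT x|\<mu>. - (m \<bullet> sgn (x - c))) \<ge> 0"
    by (intro LIMSEQ_le_const[of _ _ 0]) auto
  also have "(LINT x|\<mu>. - (m \<bullet> sgn (x - c))) = - (m \<bullet> m)"
    using sgn_int by (simp add: m_def)
  finally have "m \<bullet> m = 0" using inner_ge_zero[of m] by linarith
  then have "m = 0" by simp
  then show thesis using that by (simp add: m_def)
qed

lemma integrable_sgn_weighted:
  fixes w :: "'a \<Rightarrow> real"
  assumes "continuous_on UNIV w"
  shows "integrable \<mu> (\<lambda>x. w x *\<^sub>R sgn (x - c))"
proof -
  obtain B where B: "\<And>x. x \<in> closure \<Omega> \<Longrightarrow> norm (w x) \<le> B"
    using continuous_bounded_on_closure[OF assms] by blast
  have [measurable]: "w \<in> borel_measurable borel"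
    using assms by (rule borel_measurable_continuous_onI)
  show ?thesis
  proof (rule integrable_const_bound[of _ B])
    show "(\<lambda>x. w x *\<^sub>R sgn (x - c)) \<in> borel_measurable \<mu>"
      unfolding sgn_div_norm by (intro borel_measurable_restrict) measurable
    show "AE x in \<mu>. norm (w x *\<^sub>R sgn (x - c)) \<le> B"
    proof (rule AE_I2)
      fix x assume "x \<in> space \<mu>"
      then have "norm (w x) \<le> B" using B by (simp add: space_measure)
      then show "norm (w x *\<^sub>R sgn (x - c)) \<le> B"
        using order_trans[OF norm_ge_zero, of "w x" B] by (simp add: norm_sgn)
    qed
  qed
qed

text \<open>The functions \<open>w u\<^sub>i\<close>, \<open>u = (x - c) / |x - c|\<close>, are not continuous at \<open>c\<close>. The test functions
  are their regularisations with \<open>|x - c|\<close> replaced by \<open>sqrt (|x - c|\<^sup>2 + \<epsilon>\<^sup>2)\<close>, \<open>\<epsilon> \<longrightarrow> 0\<close>.\<close>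

lemma neumann_eigenvalue_equator_variance_le:
  assumes dim: "DIM('a) \<ge> 3" and mass: "mass > 0" and w: "C1_grad w g"
  shows "neumann_eigenvalue 1 \<Omega> \<mu> *
      ennreal ((LINT x|\<mu>. (w x)\<^sup>2) - (norm (LINT x|\<mu>. w x *\<^sub>R sgn (x - c)))\<^sup>2 / mass)
    \<le> ennreal (LINT x:\<Omega>|lborel. (w x)\<^sup>2 * (real (DIM('a) - 1) * (1 / (norm (x - c))\<^sup>2)) + (norm (g x))\<^sup>2)"
proof -
  note wc = C1_gradD(2)[OF w, of UNIV] and gc = C1_gradD(3)[OF w, of UNIV]
  have [measurable]: "w \<in> borel_measurable borel" "g \<in> borel_measurable borel"
    using wc gc by (auto intro: borel_measurable_continuous_onI)
  have \<Omega>m[measurable]: "\<Omega> \<in> sets borel" using open_domain by simp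
  obtain Bw where Bw: "\<And>x. x \<in> closure \<Omega> \<Longrightarrow> norm (w x) \<le> Bw"
    using continuous_bounded_on_closure[OF wc] by blast
  obtain Bg where Bg: "\<And>x. x \<in> closure \<Omega> \<Longrightarrow> norm (g x) \<le> Bg"
    using continuous_bounded_on_closure[OF gc] by blast
  define e where "e n = 1 / real (Suc n)" for n
  have e: "e n > 0" for n by (simp add: e_def)
  have elim0: "e \<longlonglongrightarrow> 0" unfolding e_def by (rule lim_const_over_n[THEN LIMSEQ_Suc])
  define s where "s n x = sqrt ((norm (x - c))\<^sup>2 + (e n)\<^sup>2)" for n x
  have s0: "s n x > 0" for n x using e[of n] by (simp add: s_def add_nonneg_pos)
  have sr: "s n x \<ge> norm (x - c)" for n x
    unfolding s_def by (rule real_le_rsqrt) simp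
  have slim: "(\<lambda>n. s n x) \<longlonglongrightarrow> norm (x - c)" for x
  proof -
    have "(\<lambda>n. s n x) \<longlonglongrightarrow> sqrt ((norm (x - c))\<^sup>2 + 0\<^sup>2)"
      unfolding s_def by (intro tendsto_intros elim0)
    then show ?thesis by simp
  qed
  have sm[measurable]: "s n \<in> borel_measurable borel" for n unfolding s_def[abs_def] by measurable
  define v where "v n i x = ((x - c) \<bullet> i) / s n x" for n i x
  define V where "V n i x = (1 / s n x) *\<^sub>R i - (((x - c) \<bullet> i) / s n x ^ 3) *\<^sub>R (x - c)" for n i x
  have v: "C1_grad (v n i) (V n i)" for n i
    unfolding v_def[abs_def] V_def[abs_def] s_def by (rule C1_grad_regularised_coordinate[OF e])
  define F where "F n i x = w x * v n i x" for n i x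
  define G where "G n i x = w x *\<^sub>R V n i x + v n i x *\<^sub>R g x" for n i x
  have F: "C1_grad (F n i) (G n i)" for n i
    unfolding F_def[abs_def] G_def[abs_def] by (rule C1_grad_mult[OF w v])
  note Fc = C1_gradD(2)[OF F, of UNIV] and Gc = C1_gradD(3)[OF F, of UNIV]
  have [measurable]: "F n i \<in> borel_measurable borel" "G n i \<in> borel_measurable borel" for n i
    using Fc Gc by (auto intro: borel_measurable_continuous_onI)
  define F' where "F' i x = w x * (sgn (x - c) \<bullet> i)" for i x
  define G' where "G' i x = w x *\<^sub>R ((1 / norm (x - c)) *\<^sub>R i - (((x - c) \<bullet> i) / norm (x - c) ^ 3) *\<^sub>R (x - c))
      + (((x - c) \<bullet> i) / norm (x - c)) *\<^sub>R g x" for i x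
  have [measurable]: "F' i \<in> borel_measurable borel" "G' i \<in> borel_measurable borel" for i
    unfolding F'_def[abs_def] G'_def[abs_def] sgn_div_norm by measurable

  have vle: "\<bar>v n i x\<bar> \<le> 1" if "i \<in> Basis" for n i x
  proof -
    have "\<bar>(x - c) \<bullet> i\<bar> \<le> s n x" using Basis_le_norm[OF that, of "x - c"] sr[of x n] by linarith
    then show ?thesis using s0[of n x] by (simp add: v_def)
  qed
  have Fle: "\<bar>F n i x\<bar> \<le> \<bar>w x\<bar>" if "i \<in> Basis" for n i x
    using vle[OF that] by (simp add: F_def abs_mult mult_left_le)
  have Flim: "(\<lambda>n. F n i x) \<longlonglongrightarrow> F' i x" if "x \<noteq> c" for i x
  proof -
    have "(\<lambda>n. w x * (((x - c) \<bullet> i) / s n x)) \<longlonglongrightarrow> w x * (((x - c) \<bullet> i) / norm (x - c))"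
      using that by (intro tendsto_intros slim) simp
    then show ?thesis by (simp add: F_def v_def F'_def sgn_div_norm divide_inverse mult.commute)
  qed
  have Glim: "(\<lambda>n. G n i x) \<longlonglongrightarrow> G' i x" if "x \<noteq> c" for i x
    unfolding G_def v_def V_def G'_def using that by (intro tendsto_intros slim) simp_all
  \<comment> \<open>The bound does not depend on \<open>n\<close>: \<open>s n x\<close> is at least
    |x - c|, so either part of the regularised gradient \<open>V n i x\<close> is at most 1 / |x -
    c|.\<close>
  have Gle: "norm (G n i x) \<le> 2 * Bw / norm (x - c) + Bg" if x: "x \<in> \<Omega>" "x \<noteq> c" and i: "i \<in> Basis" for n i x
  proof -
    have xc: "x \<in> closure \<Omega>" using x closure_subset by blast
    define r where "r = norm (x - c)"
    have r: "r > 0" using x by (simp add: r_def)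
    have rs: "r \<le> s n x" using sr by (simp add: r_def)
    have ir: "\<bar>(x - c) \<bullet> i\<bar> \<le> r" using Basis_le_norm[OF i] by (simp add: r_def)
    have 1: "1 / s n x \<le> 1 / r" using rs r by (simp add: frac_le)
    have 2: "\<bar>(x - c) \<bullet> i\<bar> / s n x ^ 3 * r \<le> 1 / r"
    proof -
      have "\<bar>(x - c) \<bullet> i\<bar> / s n x ^ 3 * r \<le> r / r ^ 3 * r"
        using ir rs r by (intro mult_right_mono frac_le power_mono) auto
      then show ?thesis using r by (simp add: power3_eq_cube)
    qed
    have "norm (V n i x) \<le> norm ((1 / s n x) *\<^sub>R i) + norm ((((x - c) \<bullet> i) / s n x ^ 3) *\<^sub>R (x - c))"
      unfolding V_def by (rule norm_triangle_ineq4)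
    also have "\<dots> = 1 / s n x + \<bar>(x - c) \<bullet> i\<bar> / s n x ^ 3 * r"
      using s0[of n x] i by (simp add: r_def abs_divide)
    also have "\<dots> \<le> 2 / r" using 1 2 by simp
    finally have Vle: "norm (V n i x) \<le> 2 / r" .
    have "norm (G n i x) \<le> norm (w x *\<^sub>R V n i x) + norm (v n i x *\<^sub>R g x)"
      unfolding G_def by (rule norm_triangle_ineq)
    also have "\<dots> = \<bar>w x\<bar> * norm (V n i x) + \<bar>v n i x\<bar> * norm (g x)" by simp
    also have "\<dots> \<le> Bw * (2 / r) + 1 * Bg"
      using Bw[OF xc] Bg[OF xc] Vle vle[OF i, of n x] r
      by (intro add_mono mult_mono) (auto intro: order_trans[OF norm_ge_zero])
    finally show ?thesis by (simp add: r_def mult.commute)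
  qed
  \<comment> \<open>The coefficients come from (p + q)^2 \<le> 2 p^2 + 2 q^2 applied to the bound
    just shown; their sum serves for both terms.\<close>
  define K where "K = 8 * Bw\<^sup>2 + 2 * Bg\<^sup>2"
  have G2le: "(norm (G n i x))\<^sup>2 \<le> K * (1 / (norm (x - c))\<^sup>2) + K" if x: "x \<in> \<Omega>" "x \<noteq> c" and i: "i \<in> Basis" for n i x
  proof -
    have "(norm (G n i x))\<^sup>2 \<le> (2 * Bw / norm (x - c) + Bg)\<^sup>2"
      using Gle[OF that] by (intro power_mono) auto
    also have "\<dots> \<le> 2 * (2 * Bw / norm (x - c))\<^sup>2 + 2 * Bg\<^sup>2"
    proof -
      have "(p + q)\<^sup>2 \<le> 2 * p\<^sup>2 + 2 * q\<^sup>2" for p q :: real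
        using zero_le_power2[of "p - q"] by (simp add: power2_eq_square algebra_simps)
      then show ?thesis .
    qed
    also have "2 * (2 * Bw / norm (x - c))\<^sup>2 = 8 * Bw\<^sup>2 * (1 / (norm (x - c))\<^sup>2)"
      by (simp add: power_divide power_mult_distrib)
    also have "\<dots> + 2 * Bg\<^sup>2 \<le> K * (1 / (norm (x - c))\<^sup>2) + K"
      unfolding K_def by (intro add_mono mult_right_mono) auto
    finally show ?thesis .
  qed
  have bound_int: "integrable lborel (\<lambda>x. indicator \<Omega> x *\<^sub>R (K * (1 / (norm (x - c))\<^sup>2) + K))"
  proof -
    have "set_integrable lborel \<Omega> (\<lambda>x. K * (1 / (norm (x - c))\<^sup>2) + K)"
    proof (intro set_integral_add set_integrable_mult_right)
      show "set_integrable lborel \<Omega> (\<lambda>x. 1 / (norm (x - c))\<^sup>2)"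
        by (rule set_integrable_inverse_square[OF dim \<Omega>m bounded_domain])
      show "set_integrable lborel \<Omega> (\<lambda>x. K)"
        unfolding set_integrable_def using emeasure_bounded_finite[OF bounded_domain]
        by (intro integrable_scaleR_left integrable_real_indicator) auto
    qed
    then show ?thesis by (simp add: set_integrable_def)
  qed
  have neqc: "AE x in lborel. x \<noteq> c" by (rule AE_lborel_neq)
  have G2bound: "AE x in lborel. norm (indicator \<Omega> x *\<^sub>R (norm (G n i x))\<^sup>2) \<le> indicator \<Omega> x *\<^sub>R (K * (1 / (norm (x - c))\<^sup>2) + K)"
    if i: "i \<in> Basis" for n i
    using neqc
  proof eventually_elim
    case (elim x)
    then show ?case using G2le[OF _ elim i, of n] by (cases "x \<in> \<Omega>") simp_all
  qed
  have G2lim: "AE x in lborel. (\<lambda>n. indicator \<Omega> x *\<^sub>R (norm (G n i x))\<^sup>2) \<longlonglongrightarrow> indicator \<Omega> x *\<^sub>R (norm (G' i x))\<^sup>2" for i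
    using neqc by eventually_elim (intro tendsto_intros Glim)
  have G2conv: "(\<lambda>n. LINT x|lborel. indicator \<Omega> x *\<^sub>R (norm (G n i x))\<^sup>2) \<longlonglongrightarrow>
        (LINT x|lborel. indicator \<Omega> x *\<^sub>R (norm (G' i x))\<^sup>2)" if i: "i \<in> Basis" for i
    by (rule integral_dominated_convergence[OF _ _ bound_int G2lim G2bound[OF i]]) measurable
  have G2int: "integrable lborel (\<lambda>x. indicator \<Omega> x *\<^sub>R (norm (G' i x))\<^sup>2)" if i: "i \<in> Basis" for i
    by (rule integrable_dominated_convergence[OF _ _ bound_int G2lim G2bound[OF i]]) measurable
  have G2intn: "integrable lborel (\<lambda>x. indicator \<Omega> x *\<^sub>R (norm (G n i x))\<^sup>2)" if i: "i \<in> Basis" for n i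
    by (rule integrable_dominated_convergence2[OF _ _ bound_int G2lim G2bound[OF i]]) measurable

  have cm: "f \<in> borel_measurable \<mu>" if "f \<in> borel_measurable borel" for f :: "'a \<Rightarrow> real"
    using that by (rule borel_measurable_restrict)
  \<comment> \<open>The regularisations converge to \<open>F'\<close> only away from
    \<open>c\<close>. Under \<mu> this is almost everywhere thanks to nonatomicity, and the
    dominating functions are |w| and w^2.\<close>
  have neqc\<mu>: "AE x in \<mu>. x \<noteq> c" by (rule AE_measure_neq)
  have Fconv: "(\<lambda>n. LINT x|\<mu>. F n i x) \<longlonglongrightarrow> (LINT x|\<mu>. F' i x)" if i: "i \<in> Basis" for i
  proof (rule integral_dominated_convergence)
    show "integrable \<mu> (\<lambda>x. \<bar>w x\<bar>)" using wc by (intro continuous_integrable continuous_intros)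
    show "AE x in \<mu>. (\<lambda>n. F n i x) \<longlonglongrightarrow> F' i x" using neqc\<mu> by eventually_elim (rule Flim)
    show "AE x in \<mu>. norm (F n i x) \<le> \<bar>w x\<bar>" for n using Fle[OF i] by (auto intro!: AE_I2)
  qed (auto intro!: cm)
  have F2lim: "AE x in \<mu>. (\<lambda>n. (F n i x)\<^sup>2) \<longlonglongrightarrow> (F' i x)\<^sup>2" for i
    using neqc\<mu> by eventually_elim (intro tendsto_intros Flim)
  have F2le: "AE x in \<mu>. norm ((F n i x)\<^sup>2) \<le> (w x)\<^sup>2" if i: "i \<in> Basis" for n i
    using Fle[OF i] by (auto intro!: AE_I2 simp: abs_le_square_iff[symmetric])
  have w2int: "integrable \<mu> (\<lambda>x. (w x)\<^sup>2)" using wc by (intro continuous_integrable continuous_intros)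
  have F2conv: "(\<lambda>n. LINT x|\<mu>. (F n i x)\<^sup>2) \<longlonglongrightarrow> (LINT x|\<mu>. (F' i x)\<^sup>2)" if i: "i \<in> Basis" for i
    by (rule integral_dominated_convergence[OF _ _ w2int F2lim F2le[OF i]]) (auto intro!: cm)
  have F2int: "integrable \<mu> (\<lambda>x. (F' i x)\<^sup>2)" if i: "i \<in> Basis" for i
    by (rule integrable_dominated_convergence[OF _ _ w2int F2lim F2le[OF i]]) (auto intro!: cm)

  define A where "A n = (\<Sum>i\<in>Basis. (LINT x|\<mu>. (F n i x)\<^sup>2) - (LINT x|\<mu>. F n i x)\<^sup>2 / mass)" for n
  define R where "R n = (\<Sum>i\<in>Basis. LINT x|lborel. indicator \<Omega> x *\<^sub>R (norm (G n i x))\<^sup>2)" for n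
  have le: "neumann_eigenvalue 1 \<Omega> \<mu> * ennreal (A n) \<le> ennreal (R n)" for n
  proof -
    have "neumann_eigenvalue 1 \<Omega> \<mu> * ennreal (A n) \<le> neumann_eigenvalue 1 \<Omega> \<mu> *
        (\<Sum>i\<in>Basis. ennreal ((LINT x|\<mu>. (F n i x)\<^sup>2) - (LINT x|\<mu>. F n i x)\<^sup>2 / mass))"
      unfolding A_def by (intro mult_left_mono ennreal_sum_le) auto
    also have "\<dots> = (\<Sum>i\<in>Basis. neumann_eigenvalue 1 \<Omega> \<mu> * ennreal ((LINT x|\<mu>. (F n i x)\<^sup>2) - (LINT x|\<mu>. F n i x)\<^sup>2 / mass))"
      by (rule sum_distrib_left)
    also have "\<dots> \<le> (\<Sum>i\<in>Basis. ennreal (LINT x|lborel. indicator \<Omega> x *\<^sub>R (norm (G n i x))\<^sup>2))"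
    proof (rule sum_mono)
      fix i :: 'a assume i: "i \<in> Basis"
      have "neumann_eigenvalue 1 \<Omega> \<mu> * ennreal ((LINT x|\<mu>. (F n i x)\<^sup>2) - (LINT x|\<mu>. F n i x)\<^sup>2 / mass) \<le>
          (\<integral>\<^sup>+x\<in>\<Omega>. ennreal ((norm (G n i x))\<^sup>2) \<partial>lborel)"
        by (rule neumann_eigenvalue_variance_le[OF F mass])
      also have "\<dots> = (\<integral>\<^sup>+x. ennreal (indicator \<Omega> x *\<^sub>R (norm (G n i x))\<^sup>2) \<partial>lborel)"
        by (intro nn_integral_cong) (simp add: indicator_def)
      also have "\<dots> = ennreal (LINT x|lborel. indicator \<Omega> x *\<^sub>R (norm (G n i x))\<^sup>2)"
        by (rule nn_integral_eq_integral[OF G2intn[OF i]]) simp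
      finally show "neumann_eigenvalue 1 \<Omega> \<mu> * ennreal ((LINT x|\<mu>. (F n i x)\<^sup>2) - (LINT x|\<mu>. F n i x)\<^sup>2 / mass)
        \<le> ennreal (LINT x|lborel. indicator \<Omega> x *\<^sub>R (norm (G n i x))\<^sup>2)" .
    qed
    also have "\<dots> = ennreal (R n)"
      unfolding R_def by (intro sum_ennreal Bochner_Integration.integral_nonneg) simp
    finally show ?thesis .
  qed
  have "A \<longlonglongrightarrow> (\<Sum>i\<in>Basis. (LINT x|\<mu>. (F' i x)\<^sup>2) - (LINT x|\<mu>. F' i x)\<^sup>2 / mass)"
    unfolding A_def[abs_def] using mass by (intro tendsto_intros Fconv F2conv) simp_all
  moreover have "R \<longlonglongrightarrow> (\<Sum>i\<in>Basis. LINT x|lborel. indicator \<Omega> x *\<^sub>R (norm (G' i x))\<^sup>2)"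
    unfolding R_def[abs_def] by (intro tendsto_intros G2conv)
  ultimately have main: "neumann_eigenvalue 1 \<Omega> \<mu> *
     ennreal (\<Sum>i\<in>Basis. (LINT x|\<mu>. (F' i x)\<^sup>2) - (LINT x|\<mu>. F' i x)\<^sup>2 / mass) \<le>
     ennreal (\<Sum>i\<in>Basis. LINT x|lborel. indicator \<Omega> x *\<^sub>R (norm (G' i x))\<^sup>2)"
    using le by (rule ennreal_mult_le_limit[rotated])
  \<comment> \<open>The squared coordinates of a unit vector add up to 1, which leaves w^2; the
    coordinate means are the coordinates of one vector integral.\<close>
  have "(\<Sum>i\<in>Basis. (LINT x|\<mu>. (F' i x)\<^sup>2) - (LINT x|\<mu>. F' i x)\<^sup>2 / mass) =
      (LINT x|\<mu>. (w x)\<^sup>2) - (norm (LINT x|\<mu>. w x *\<^sub>R sgn (x - c)))\<^sup>2 / mass"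
  proof -
    have sq: "(\<Sum>i\<in>Basis. (z \<bullet> i)\<^sup>2) = (norm z)\<^sup>2" for z :: 'a
      unfolding power2_norm_eq_inner by (subst euclidean_inner) (simp add: power2_eq_square)
    have "(\<Sum>i\<in>Basis. LINT x|\<mu>. (F' i x)\<^sup>2) = (LINT x|\<mu>. (\<Sum>i\<in>Basis. (F' i x)\<^sup>2))"
      using F2int by (intro Bochner_Integration.integral_sum[symmetric]) auto
    also have "\<dots> = (LINT x|\<mu>. (w x)\<^sup>2)"
    proof (rule integral_cong_AE)
      show "AE x in \<mu>. (\<Sum>i\<in>Basis. (F' i x)\<^sup>2) = (w x)\<^sup>2"
        using neqc\<mu>
        by eventually_elim (simp add: F'_def power_mult_distrib sum_distrib_left[symmetric] sq norm_sgn)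
    qed (auto intro!: cm)
    finally have 1: "(\<Sum>i\<in>Basis. LINT x|\<mu>. (F' i x)\<^sup>2) = (LINT x|\<mu>. (w x)\<^sup>2)" .
    have "(LINT x|\<mu>. F' i x) = (LINT x|\<mu>. w x *\<^sub>R sgn (x - c)) \<bullet> i" for i
      using integral_inner_left[of i \<mu> "\<lambda>x. w x *\<^sub>R sgn (x - c)"] integrable_sgn_weighted[OF wc]
      by (simp add: F'_def)
    then have 2: "(\<Sum>i\<in>Basis. (LINT x|\<mu>. F' i x)\<^sup>2) = (norm (LINT x|\<mu>. w x *\<^sub>R sgn (x - c)))\<^sup>2"
      by (simp add: sq)
    show ?thesis by (simp add: sum_subtractf 1 sum_divide_distrib[symmetric] 2)
  qed
  moreover have "(\<Sum>i\<in>Basis. LINT x|lborel. indicator \<Omega> x *\<^sub>R (norm (G' i x))\<^sup>2) =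
      (LINT x:\<Omega>|lborel. (w x)\<^sup>2 * (real (DIM('a) - 1) * (1 / (norm (x - c))\<^sup>2)) + (norm (g x))\<^sup>2)"
  proof -
    have "(\<Sum>i\<in>Basis. LINT x|lborel. indicator \<Omega> x *\<^sub>R (norm (G' i x))\<^sup>2) =
        (LINT x|lborel. (\<Sum>i\<in>Basis. indicator \<Omega> x *\<^sub>R (norm (G' i x))\<^sup>2))"
      using G2int by (intro Bochner_Integration.integral_sum[symmetric]) auto
    also have "\<dots> = (LINT x:\<Omega>|lborel. (w x)\<^sup>2 * (real (DIM('a) - 1) * (1 / (norm (x - c))\<^sup>2)) + (norm (g x))\<^sup>2)"
      unfolding set_lebesgue_integral_def
    proof (rule integral_cong_AE)
      show "AE x in lborel. (\<Sum>i\<in>Basis. indicator \<Omega> x *\<^sub>R (norm (G' i x))\<^sup>2) =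
          indicator \<Omega> x *\<^sub>R ((w x)\<^sup>2 * (real (DIM('a) - 1) * (1 / (norm (x - c))\<^sup>2)) + (norm (g x))\<^sup>2)"
        using neqc
      proof eventually_elim
        case (elim x)
        then have "x - c \<noteq> 0" by simp
        from sum_norm_weighted_equator_gradient[OF this, of "w x" "g x"] show ?case
          unfolding G'_def scaleR_sum_right[symmetric] by simp
      qed
    qed measurable
    finally show ?thesis .
  qed
  ultimately show ?thesis using main by simp
qed

end

section \<open>The case of equality\<close>

text \<open>The polynomial attains its minimum 0 at t = 0, so its derivative there vanishes.
  Explicitly, t = -x/m with m > 0 and m > k gives the value (x^2/m)(k/m - 2), which is negative
  unless x = 0.\<close>

lemma quadratic_nonneg_imp_linear_zero:
  fixes x k :: real
  assumes "\<And>t. 0 \<le> 2 * t * x + t\<^sup>2 * k"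
  shows "x = 0"
proof (rule ccontr)
  assume x: "x \<noteq> 0"
  define m where "m = \<bar>k\<bar> + 1"
  have m: "m > 0" "k < m" by (auto simp: m_def)
  have "2 * (- x / m) * x + (- x / m)\<^sup>2 * k = x\<^sup>2 / m * (k / m - 2)"
    using m by (simp add: power2_eq_square field_simps)
  moreover have "x\<^sup>2 / m > 0" using x m by simp
  moreover have "k / m - 2 < 0" using m by (simp add: field_simps)
  ultimately have "2 * (- x / m) * x + (- x / m)\<^sup>2 * k < 0"
    by (metis mult_pos_neg)
  then show False using assms[of "- x / m"] by linarith
qed

context nonatomic_neumann_problem
begin

lemma set_integrable_mult_inverse_square:
  fixes \<psi> :: "'a \<Rightarrow> real"
  assumes dim: "DIM('a) \<ge> 3" and \<psi>: "\<psi> \<in> borel_measurable borel" and B: "\<And>x. x \<in> \<Omega> \<Longrightarrow> \<bar>\<psi> x\<bar> \<le> B"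
  shows "set_integrable lborel \<Omega> (\<lambda>x. \<psi> x * (k * (1 / (norm (x - c))\<^sup>2)))"
proof -
  have [measurable]: "\<Omega> \<in> sets borel" using open_domain by simp
  have int: "set_integrable lborel \<Omega> (\<lambda>x. (B * \<bar>k\<bar>) * (1 / (norm (x - c))\<^sup>2))"
    using dim bounded_domain by (intro set_integrable_mult_right set_integrable_inverse_square) auto
  show ?thesis
    unfolding set_integrable_def
  proof (rule Bochner_Integration.integrable_bound[OF int[unfolded set_integrable_def]])
    show "AE x in lborel. norm (indicat_real \<Omega> x *\<^sub>R (\<psi> x * (k * (1 / (norm (x - c))\<^sup>2)))) \<le>
        norm (indicat_real \<Omega> x *\<^sub>R ((B * \<bar>k\<bar>) * (1 / (norm (x - c))\<^sup>2)))"
    proof (rule AE_I2)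
      fix x
      have "\<bar>\<psi> x\<bar> * (\<bar>k\<bar> * (1 / (norm (x - c))\<^sup>2)) \<le> \<bar>B\<bar> * (\<bar>k\<bar> * (1 / (norm (x - c))\<^sup>2))" if "x \<in> \<Omega>"
        using B[OF that] by (intro mult_right_mono) auto
      then show "norm (indicat_real \<Omega> x *\<^sub>R (\<psi> x * (k * (1 / (norm (x - c))\<^sup>2)))) \<le>
          norm (indicat_real \<Omega> x *\<^sub>R ((B * \<bar>k\<bar>) * (1 / (norm (x - c))\<^sup>2)))"
        by (cases "x \<in> \<Omega>") (simp_all add: abs_mult mult.assoc)
    qed
  qed (use \<psi> in measurable)
qed

text \<open>The Euler--Lagrange equation of the constant weight, which by \<open>eq\<close> attains
  equality in the variance inequality. The variation 1 + t \<psi> therefore leaves a nonnegative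
  quadratic in t without constant term.\<close>

lemma weak_eigenvalue_equation:
  fixes c :: 'a
  defines "h \<equiv> \<lambda>x. real (DIM('a) - 1) * (1 / (norm (x - c))\<^sup>2)"
  assumes dim: "DIM('a) \<ge> 3" and mass: "mass > 0"
    and c: "(LINT x|\<mu>. sgn (x - c)) = 0"
    and L: "L \<ge> 0" "neumann_eigenvalue 1 \<Omega> \<mu> = ennreal L"
    and eq: "L * mass = (LINT x:\<Omega>|lborel. h x)"
    and \<psi>: "C1_grad \<psi> g"
  shows "L * (LINT x|\<mu>. \<psi> x) = (LINT x:\<Omega>|lborel. \<psi> x * h x)"
proof -
  note pc = C1_gradD(2)[OF \<psi>, of UNIV] and gc = C1_gradD(3)[OF \<psi>, of UNIV]
  have [measurable]: "\<psi> \<in> borel_measurable borel" "g \<in> borel_measurable borel"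
    using pc gc by (auto intro: borel_measurable_continuous_onI)
  have [measurable]: "\<Omega> \<in> sets borel" using open_domain by simp
  have bdd: "\<exists>B. \<forall>x\<in>\<Omega>. \<bar>f x\<bar> \<le> B" if "continuous_on UNIV f" for f :: "'a \<Rightarrow> real"
    using continuous_bounded_on_closure[OF that] closure_subset
    by (metis real_norm_def subsetD)
  have hint: "set_integrable lborel \<Omega> (\<lambda>x. f x * h x)" if f: "continuous_on UNIV f" for f
  proof -
    obtain B where "\<And>x. x \<in> \<Omega> \<Longrightarrow> \<bar>f x\<bar> \<le> B" using bdd[OF f] by blast
    then show ?thesis
      unfolding h_def by (intro set_integrable_mult_inverse_square dim borel_measurable_continuous_onI f)
  qed
  have gint: "set_integrable lborel \<Omega> (\<lambda>x. (norm (g x))\<^sup>2)"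
  proof -
    have "set_integrable lborel (closure \<Omega>) (\<lambda>x. (norm (g x))\<^sup>2)"
      unfolding set_integrable_def using gc bounded_domain
      by (intro borel_integrable_compact continuous_intros) (auto intro: continuous_on_subset)
    then show ?thesis
      by (rule set_integrable_subset) (auto simp: closure_subset)
  qed
  define a1 where "a1 = (LINT x|\<mu>. \<psi> x)"
  define a2 where "a2 = (LINT x|\<mu>. (\<psi> x)\<^sup>2)"
  define a3 where "a3 = (LINT x|\<mu>. \<psi> x *\<^sub>R sgn (x - c))"
  define j0 where "j0 = (LINT x:\<Omega>|lborel. h x)"
  define j1 where "j1 = (LINT x:\<Omega>|lborel. \<psi> x * h x)"
  define j2 where "j2 = (LINT x:\<Omega>|lborel. (\<psi> x)\<^sup>2 * h x + (norm (g x))\<^sup>2)"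
  have "0 \<le> 2 * t * (j1 - L * a1) + t\<^sup>2 * (j2 - L * (a2 - (norm a3)\<^sup>2 / mass))" for t
  proof -
    define w where "w x = 1 + t * \<psi> x" for x
    have w: "C1_grad w (\<lambda>x. t *\<^sub>R g x)"
      using C1_grad_add[OF C1_grad_const C1_grad_cmult[OF \<psi>], of 1 t] by (simp add: w_def[abs_def])
    have 1: "(LINT x|\<mu>. (w x)\<^sup>2) = mass + 2 * t * a1 + t\<^sup>2 * a2"
    proof -
      have "integrable \<mu> \<psi>" "integrable \<mu> (\<lambda>x. (\<psi> x)\<^sup>2)"
        using pc by (auto intro!: continuous_integrable continuous_intros)
      moreover have "(LINT x|\<mu>. (w x)\<^sup>2) = (LINT x|\<mu>. 1 + 2 * t * \<psi> x + t\<^sup>2 * (\<psi> x)\<^sup>2)"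
        by (intro Bochner_Integration.integral_cong) (auto simp: w_def power2_eq_square algebra_simps)
      ultimately show ?thesis by (simp add: a1_def a2_def)
    qed
    \<comment> \<open>By the choice of \<open>c\<close> the constant part integrates to zero, so the
      squared norm subtracted in the variance is purely of second order in t.\<close>
    have 2: "(LINT x|\<mu>. w x *\<^sub>R sgn (x - c)) = t *\<^sub>R a3"
    proof -
      have "integrable \<mu> (\<lambda>x. sgn (x - c))" "integrable \<mu> (\<lambda>x. \<psi> x *\<^sub>R sgn (x - c))"
        using integrable_sgn_weighted[of "\<lambda>_. 1" c] integrable_sgn_weighted[OF pc] by auto
      moreover have "(LINT x|\<mu>. w x *\<^sub>R sgn (x - c)) = (LINT x|\<mu>. sgn (x - c) + t *\<^sub>R (\<psi> x *\<^sub>R sgn (x - c)))"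
        by (intro Bochner_Integration.integral_cong) (auto simp: w_def algebra_simps)
      ultimately show ?thesis
        using c by (simp add: a3_def del: scaleR_scaleR)
    qed
    have 3: "(LINT x:\<Omega>|lborel. (w x)\<^sup>2 * h x + (norm (t *\<^sub>R g x))\<^sup>2) = j0 + 2 * t * j1 + t\<^sup>2 * j2"
    proof -
      have i0: "set_integrable lborel \<Omega> h" using hint[of "\<lambda>_. 1"] by simp
      have i1: "set_integrable lborel \<Omega> (\<lambda>x. \<psi> x * h x)" using pc by (rule hint)
      have i2: "set_integrable lborel \<Omega> (\<lambda>x. (\<psi> x)\<^sup>2 * h x + (norm (g x))\<^sup>2)"
        using pc by (intro set_integral_add hint gint continuous_intros)
      have "(LINT x:\<Omega>|lborel. (w x)\<^sup>2 * h x + (norm (t *\<^sub>R g x))\<^sup>2) =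
        (LINT x:\<Omega>|lborel. (h x + (2 * t) * (\<psi> x * h x)) + t\<^sup>2 * ((\<psi> x)\<^sup>2 * h x + (norm (g x))\<^sup>2))"
        by (intro set_lebesgue_integral_cong) (auto simp: w_def power_mult_distrib power2_eq_square algebra_simps)
      also have "\<dots> = (j0 + (2 * t) * j1) + t\<^sup>2 * j2"
        unfolding j0_def j1_def j2_def
        by (simp only: set_integral_add set_integrable_mult_right set_integral_mult_right i0 i1 i2)
      finally show ?thesis .
    qed
    have "ennreal L * ennreal ((mass + 2 * t * a1 + t\<^sup>2 * a2) - (norm (t *\<^sub>R a3))\<^sup>2 / mass) \<le> ennreal (j0 + 2 * t * j1 + t\<^sup>2 * j2)"
      using neumann_eigenvalue_equator_variance_le[OF dim mass w, of c]
      unfolding 1 2 3[unfolded h_def] L(2) .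
    then have "ennreal (L * ((mass + 2 * t * a1 + t\<^sup>2 * a2) - (norm (t *\<^sub>R a3))\<^sup>2 / mass)) \<le> ennreal (j0 + 2 * t * j1 + t\<^sup>2 * j2)"
      by (simp only: ennreal_mult'[OF L(1)])
    \<comment> \<open>Nonnegativity of the right-hand side is needed to return to real numbers,
      since \<open>ennreal\<close> would clip a negative bound to 0.\<close>
    moreover have "0 \<le> j0 + 2 * t * j1 + t\<^sup>2 * j2"
      unfolding 3[symmetric] set_lebesgue_integral_def
      by (intro Bochner_Integration.integral_nonneg) (auto simp: h_def)
    ultimately have "L * ((mass + 2 * t * a1 + t\<^sup>2 * a2) - (norm (t *\<^sub>R a3))\<^sup>2 / mass) \<le> j0 + 2 * t * j1 + t\<^sup>2 * j2"
      by (simp only: ennreal_le_iff)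
    moreover have "L * ((mass + 2 * t * a1 + t\<^sup>2 * a2) - (norm (t *\<^sub>R a3))\<^sup>2 / mass) =
        L * mass + 2 * t * (L * a1) + t\<^sup>2 * (L * (a2 - (norm a3)\<^sup>2 / mass))"
      by (simp add: power_mult_distrib algebra_simps)
    moreover have "L * mass = j0" using eq by (simp add: j0_def)
    ultimately show ?thesis by (simp add: algebra_simps)
  qed
  then have "j1 - L * a1 = 0" by (rule quadratic_nonneg_imp_linear_zero)
  then show ?thesis by (simp add: a1_def j1_def)
qed

text \<open>The eigenvalue equation is applied to bumps and passed to the limit on both sides. The
  equation holds for every C^1 function on the whole space, so the box need not lie in \<Omega> and
  the part of \<mu> on the boundary is captured too.\<close>

lemma measure_box_eq:
  fixes c :: 'a
  defines "h \<equiv> \<lambda>x. real (DIM('a) - 1) * (1 / (norm (x - c))\<^sup>2)"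
  assumes dim: "DIM('a) \<ge> 3" and mass: "mass > 0"
    and c: "(LINT x|\<mu>. sgn (x - c)) = 0"
    and L: "L \<ge> 0" "neumann_eigenvalue 1 \<Omega> \<mu> = ennreal L"
    and eq: "L * mass = (LINT x:\<Omega>|lborel. h x)"
  shows "L * measure \<mu> (box a q \<inter> space \<mu>) = (LINT x:\<Omega>|lborel. indicator (box a q) x * h x)"
proof (cases "box a q = {}")
  case False
  have [measurable]: "\<Omega> \<in> sets borel" using open_domain by simp
  have bc: "continuous_on UNIV (box_bump a q n)" for n
    using smooth_terms_Ck[OF box_bump_smooth, of 0] by simp
  have [measurable]: "box_bump a q n \<in> borel_measurable borel" for n
    using bc by (rule borel_measurable_continuous_onI)
  have hm[measurable]: "h \<in> borel_measurable borel" unfolding h_def by measurable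
  have im: "indicat_real (box a q) \<in> borel_measurable borel" by simp
  have hint: "integrable lborel (\<lambda>x. indicator \<Omega> x *\<^sub>R (1 * h x))"
    using set_integrable_mult_inverse_square[OF dim, of "\<lambda>_. 1" 1 "real (DIM('a) - 1)" c]
    by (simp add: set_integrable_def h_def)
  have "(\<lambda>n. L * (LINT x|\<mu>. box_bump a q n x)) \<longlonglongrightarrow> L * (LINT x|\<mu>. indicator (box a q) x)"
  proof (intro tendsto_mult tendsto_const integral_dominated_convergence)
    show "integrable \<mu> (\<lambda>_. 1 :: real)" by simp
    show "AE x in \<mu>. (\<lambda>n. box_bump a q n x) \<longlonglongrightarrow> indicator (box a q) x"
      by (intro AE_I2 box_bump_tendsto False)
    show "AE x in \<mu>. norm (box_bump a q n x) \<le> 1" for n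
      by (intro AE_I2) (simp add: box_bump_bounds abs_of_nonneg)
  qed (auto intro!: borel_measurable_restrict)
  moreover have "(\<lambda>n. LINT x:\<Omega>|lborel. box_bump a q n x * h x) \<longlonglongrightarrow> (LINT x:\<Omega>|lborel. indicator (box a q) x * h x)"
    unfolding set_lebesgue_integral_def
  proof (rule integral_dominated_convergence[OF _ _ hint])
    show "AE x in lborel. (\<lambda>n. indicator \<Omega> x *\<^sub>R (box_bump a q n x * h x)) \<longlonglongrightarrow> indicator \<Omega> x *\<^sub>R (indicator (box a q) x * h x)"
      by (intro AE_I2 tendsto_intros box_bump_tendsto False)
    show "AE x in lborel. norm (indicator \<Omega> x *\<^sub>R (box_bump a q n x * h x)) \<le> indicator \<Omega> x *\<^sub>R (1 * h x)" for n
    proof (rule AE_I2)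
      fix x
      have "h x \<ge> 0" by (simp add: h_def)
      then have "box_bump a q n x * h x \<le> 1 * h x" by (intro mult_right_mono box_bump_bounds)
      then show "norm (indicator \<Omega> x *\<^sub>R (box_bump a q n x * h x)) \<le> indicator \<Omega> x *\<^sub>R (1 * h x)"
        using \<open>h x \<ge> 0\<close> box_bump_bounds[of a q n x] by (cases "x \<in> \<Omega>") (simp_all add: abs_mult)
    qed
    show "(\<lambda>x. indicator \<Omega> x *\<^sub>R (indicat_real (box a q) x * h x)) \<in> borel_measurable lborel"
      using im by simp
  qed measurable
  moreover have "L * (LINT x|\<mu>. box_bump a q n x) = (LINT x:\<Omega>|lborel. box_bump a q n x * h x)" for n
    unfolding h_def
    by (rule weak_eigenvalue_equation[OF dim mass c L eq[unfolded h_def] C1_grad_Ck])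
       (rule smooth_terms_Ck[OF box_bump_smooth])
  ultimately have "L * (LINT x|\<mu>. indicator (box a q) x) = (LINT x:\<Omega>|lborel. indicator (box a q) x * h x)"
    using LIMSEQ_unique by simp
  then show ?thesis by simp
qed (simp add: set_lebesgue_integral_def)

end

section \<open>Energy of the equator map and assembly of the result\<close>

lemma equator_energy_eq_inverse_square:
  "equator_energy TYPE('a::euclidean_space) =
     ennreal (real (DIM('a) - 1)) * (\<integral>\<^sup>+x\<in>ball (0::'a) 1. ennreal (1 / (norm x)\<^sup>2) \<partial>lborel)"
proof -
  have [measurable]: "ball (0::'a) 1 \<in> sets borel" by simp
  have "equator_energy TYPE('a) =
     (\<integral>\<^sup>+x. ennreal (real (DIM('a) - 1)) * (ennreal (1 / (norm x)\<^sup>2) * indicator (ball (0::'a) 1) x) \<partial>lborel)"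
    unfolding equator_energy_eq by (intro nn_integral_cong) (subst ennreal_mult, auto simp: mult.assoc)
  also have "\<dots> = ennreal (real (DIM('a) - 1)) * (\<integral>\<^sup>+x\<in>ball (0::'a) 1. ennreal (1 / (norm x)\<^sup>2) \<partial>lborel)"
    by (rule nn_integral_cmult) measurable
  finally show ?thesis .
qed

text \<open>In the case of equality, finiteness excludes an infinite eigenvalue and positivity
  excludes a vanishing one. Positivity also shows that the zero measure never attains
  equality.\<close>

lemma equator_energy_pos_finite:
  assumes "DIM('a::euclidean_space) \<ge> 3"
  shows "0 < equator_energy TYPE('a)" and "equator_energy TYPE('a) < \<infinity>"
proof -
  let ?I = "\<integral>\<^sup>+x\<in>ball (0::'a) 1. ennreal (1 / (norm x)\<^sup>2) \<partial>lborel"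
  have [measurable]: "ball (0::'a) 1 \<in> sets borel" by simp
  have "?I \<noteq> 0"
  proof
    assume "?I = 0"
    then have "AE x in lborel. ennreal (1 / (norm x)\<^sup>2) * indicator (ball (0::'a) 1) x = 0"
      by (subst (asm) nn_integral_0_iff_AE) measurable
    then have "AE x in lborel. x \<notin> ball (0::'a) 1"
      using AE_lborel_neq[of 0] by eventually_elim (auto simp: indicator_def ennreal_eq_0_iff)
    then have "ball (0::'a) 1 \<in> null_sets lborel" by (simp add: AE_iff_null_sets)
    then have "emeasure lborel (ball (0::'a) 1) = 0" by auto
    then have "unit_ball_vol (real DIM('a)) \<le> 0" by (simp add: emeasure_ball ennreal_eq_0_iff)
    moreover have "unit_ball_vol (real DIM('a)) > 0" by (rule unit_ball_vol_pos) simp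
    ultimately show False by linarith
  qed
  then show "0 < equator_energy TYPE('a)"
    using assms by (simp add: equator_energy_eq_inverse_square zero_less_iff_neq_zero)
  show "equator_energy TYPE('a) < \<infinity>"
    using nn_integral_inverse_square_ball_finite[OF assms]
    by (simp add: equator_energy_eq_inverse_square ennreal_mult_less_top)
qed

context nonatomic_neumann_problem
begin

text \<open>Both measures are compared on boxes, an intersection-stable generator. Up to the null
  set, \<Omega> may be replaced by the ball about \<open>c\<close>, and translation invariance moves
  the integral to the origin.\<close>

lemma distr_translation_eq_density:
  fixes c :: 'a
  assumes C: "C \<ge> 0"
    and null: "sym_diff \<Omega> (ball c 1) \<in> null_sets lborel"
    and int: "set_integrable lborel \<Omega> (\<lambda>x. 1 / (norm (x - c))\<^sup>2)"
    and box: "\<And>a q. measure \<mu> (box a q \<inter> space \<mu>) = (LINT x:\<Omega>|lborel. indicator (box a q) x * (C * (1 / (norm (x - c))\<^sup>2)))"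
  shows "distr \<mu> borel (\<lambda>x. x - c) = density lborel (\<lambda>x. ennreal (C / (norm x)\<^sup>2) * indicator (ball 0 1) x)"
    (is "?M = ?N")
proof (rule measure_eqI_generator_eq)
  have [measurable]: "\<Omega> \<in> sets borel" "ball (0::'a) 1 \<in> sets borel" using open_domain by auto
  have T: "(\<lambda>x. x - c) \<in> \<mu> \<rightarrow>\<^sub>M borel" by (rule borel_measurable_restrict) measurable
  let ?E = "range (\<lambda>(a, b). box a b::'a set)"
  show "Int_stable ?E" by (auto simp: Int_stable_def box_Int_box)
  show "?E \<subseteq> Pow UNIV" "sets ?M = sigma_sets UNIV ?E" "sets ?N = sigma_sets UNIV ?E"
    by (simp_all add: borel_eq_box)
  let ?A = "\<lambda>n::nat. box (- (real n *\<^sub>R One)) (real n *\<^sub>R One) :: 'a set"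
  show "range ?A \<subseteq> ?E" "(\<Union>i. ?A i) = UNIV"
    unfolding UN_box_eq_UNIV by auto
  show "emeasure ?M (?A i) \<noteq> \<infinity>" for i
    using T by (simp add: emeasure_distr)
  show "emeasure ?M X = emeasure ?N X" if "X \<in> ?E" for X
  proof -
    obtain a q where X: "X = box a q" using \<open>X \<in> ?E\<close> by auto
    \<comment> \<open>The preimage of the box under the translation, to which the box formula for
      \<mu> applies.\<close>
    define X' where "X' = box (a + c) (q + c)"
    have X'iff: "x - c \<in> X \<longleftrightarrow> x \<in> X'" for x
      by (auto simp: X X'_def mem_box inner_simps less_diff_eq diff_less_eq)
    have [measurable]: "X \<in> sets borel" "X' \<in> sets borel" by (auto simp: X X'_def)
    have int': "integrable lborel (\<lambda>x. indicator \<Omega> x *\<^sub>R (indicator X' x * (C * (1 / (norm (x - c))\<^sup>2))))"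
    proof -
      have "integrable lborel (\<lambda>x. C * (indicator \<Omega> x *\<^sub>R (1 / (norm (x - c))\<^sup>2)))"
        using int unfolding set_integrable_def by (intro integrable_mult_right)
      then have "integrable lborel (\<lambda>x. indicator X' x *\<^sub>R (C * (indicator \<Omega> x *\<^sub>R (1 / (norm (x - c))\<^sup>2))))"
        by (rule integrable_mult_indicator[rotated]) (simp add: X'_def)
      then show ?thesis by (simp add: mult_ac)
    qed
    have "emeasure ?M X = emeasure \<mu> (X' \<inter> space \<mu>)"
      using T by (subst emeasure_distr) (auto simp: X'iff vimage_def Int_def)
    also have "\<dots> = ennreal (LINT x|lborel. indicator \<Omega> x *\<^sub>R (indicator X' x * (C * (1 / (norm (x - c))\<^sup>2))))"
      using box[of "a + c" "q + c"] by (simp add: emeasure_eq_measure X'_def set_lebesgue_integral_def)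
    also have "\<dots> = (\<integral>\<^sup>+x. ennreal (indicator \<Omega> x *\<^sub>R (indicator X' x * (C * (1 / (norm (x - c))\<^sup>2)))) \<partial>lborel)"
      using C by (intro nn_integral_eq_integral[symmetric] int') (auto intro!: AE_I2)
    also have "\<dots> = (\<integral>\<^sup>+x. (ennreal (C / (norm (x - c))\<^sup>2) * indicator (ball 0 1) (x - c)) * indicator X (x - c) \<partial>lborel)"
    proof (rule nn_integral_cong_AE)
      show "AE x in lborel. ennreal (indicator \<Omega> x *\<^sub>R (indicator X' x * (C * (1 / (norm (x - c))\<^sup>2)))) =
        (ennreal (C / (norm (x - c))\<^sup>2) * indicator (ball 0 1) (x - c)) * indicator X (x - c)"
        using AE_not_in[OF null]
      proof eventually_elim
        case (elim x)
        then have "x \<in> \<Omega> \<longleftrightarrow> x - c \<in> ball 0 1" by (auto simp: dist_norm norm_minus_commute)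
        then show ?case using X'iff[of x] by (cases "x \<in> \<Omega>"; cases "x \<in> X'") simp_all
      qed
    qed
    also have "\<dots> = (\<integral>\<^sup>+x. (ennreal (C / (norm x)\<^sup>2) * indicator (ball 0 1) x) * indicator X x \<partial>lborel)"
      by (rule nn_integral_lborel_translate) measurable
    also have "\<dots> = emeasure ?N X"
      by (subst emeasure_density) measurable
    finally show ?thesis .
  qed
qed

text \<open>The integral \<open>J\<close> of the energy density over \<Omega> separates the two
  estimates: \<open>J\<close> bounds mass times eigenvalue by testing, and is itself bounded by the
  energy of the equator map through rearrangement.\<close>

lemma neumann_eigenvalue_mass_le:
  assumes dim: "DIM('a) \<ge> 3" and vol: "emeasure lborel \<Omega> = emeasure lborel (ball (0::'a) 1)"
    and mass: "mass > 0"
  shows "ennreal mass * neumann_eigenvalue 1 \<Omega> \<mu> \<le> equator_energy TYPE('a)"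
    and "ennreal mass * neumann_eigenvalue 1 \<Omega> \<mu> = equator_energy TYPE('a) \<Longrightarrow>
      \<exists>T C. isometry T \<and> C > 0 \<and> sym_diff (T ` \<Omega>) (ball 0 1) \<in> null_sets lborel \<and>
         distr \<mu> borel T = density lborel (\<lambda>x. ennreal (C / (norm x)\<^sup>2) * indicator (ball 0 1) x)"
proof -
  define D where "D = real (DIM('a) - 1)"
  have D: "D > 0" using dim by (simp add: D_def)
  let ?l = "neumann_eigenvalue 1 \<Omega> \<mu>"
  obtain c where c: "(LINT x|\<mu>. sgn (x - c)) = 0" using geometric_median[OF mass] .
  define I where "I A = (\<integral>\<^sup>+x\<in>A. ennreal (1 / (norm (x - c))\<^sup>2) \<partial>lborel)" for A
  define J where "J = (LINT x:\<Omega>|lborel. D * (1 / (norm (x - c))\<^sup>2))"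
  have \<Omega>m[measurable]: "\<Omega> \<in> sets borel" using open_domain by simp
  have int: "set_integrable lborel \<Omega> (\<lambda>x. 1 / (norm (x - c))\<^sup>2)"
    by (rule set_integrable_inverse_square[OF dim \<Omega>m bounded_domain])
  have "J \<ge> 0"
    unfolding J_def set_lebesgue_integral_def using D by (intro Bochner_Integration.integral_nonneg) auto
  have J: "ennreal J = ennreal D * I \<Omega>"
  proof -
    have "ennreal J = (\<integral>\<^sup>+x. ennreal (indicator \<Omega> x *\<^sub>R (D * (1 / (norm (x - c))\<^sup>2))) \<partial>lborel)"
      unfolding J_def set_lebesgue_integral_def using D set_integrable_mult_right[OF int, of D]
      by (intro nn_integral_eq_integral[symmetric]) (auto simp: set_integrable_def intro!: AE_I2)
    also have "\<dots> = (\<integral>\<^sup>+x. ennreal D * (ennreal (1 / (norm (x - c))\<^sup>2) * indicator \<Omega> x) \<partial>lborel)"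
    proof (rule nn_integral_cong)
      fix x
      show "ennreal (indicator \<Omega> x *\<^sub>R (D * (1 / (norm (x - c))\<^sup>2))) = ennreal D * (ennreal (1 / (norm (x - c))\<^sup>2) * indicator \<Omega> x)"
        using D by (cases "x \<in> \<Omega>") (simp_all flip: ennreal_mult')
    qed
    also have "\<dots> = ennreal D * I \<Omega>" unfolding I_def by (rule nn_integral_cmult) measurable
    finally show ?thesis .
  qed
  have E: "equator_energy TYPE('a) = ennreal D * I (ball c 1)"
    unfolding I_def nn_integral_inverse_square_ball_translate D_def by (rule equator_energy_eq_inverse_square)
  \<comment> \<open>The weight 1: its gradient vanishes, and so does the mean of
    \<open>sgn (x - c)\<close>.\<close>
  have lJ: "?l * ennreal mass \<le> ennreal J"
    using neumann_eigenvalue_equator_variance_le[OF dim mass C1_grad_const[of 1], of c]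
    by (simp add: c J_def D_def)
  have JE: "ennreal J \<le> equator_energy TYPE('a)"
    unfolding J E I_def by (intro mult_left_mono inverse_square_bathtub(1)[OF dim \<Omega>m vol]) simp
  show "ennreal mass * ?l \<le> equator_energy TYPE('a)"
    using order_trans[OF lJ JE] by (simp add: mult.commute)
  assume eq: "ennreal mass * ?l = equator_energy TYPE('a)"
  \<comment> \<open>Equality of the outer terms squeezes \<open>J\<close>. Equality on the right
    determines \<Omega>, equality on the left is the hypothesis of the eigenvalue equation.\<close>
  have "ennreal J = equator_energy TYPE('a)"
    using lJ JE unfolding eq[symmetric] mult.commute[of "ennreal mass"] by (rule antisym[rotated])
  then have "ennreal D * I \<Omega> = ennreal D * I (ball c 1)" unfolding J E .
  then have "I \<Omega> = I (ball c 1)"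
    using D by (simp add: ennreal_mult_cancel_left ennreal_eq_0_iff)
  then have null: "sym_diff \<Omega> (ball c 1) \<in> null_sets lborel"
    unfolding I_def by (rule inverse_square_bathtub(2)[OF dim \<Omega>m vol])
  have "?l < \<infinity>"
  proof (rule ccontr)
    assume "\<not> ?l < \<infinity>"
    then have "?l = top" by (simp add: less_top[symmetric])
    then have "equator_energy TYPE('a) = top"
      using mass unfolding eq[symmetric] by (simp add: ennreal_mult_top ennreal_eq_0_iff)
    then show False using equator_energy_pos_finite(2)[OF dim] by simp
  qed
  then obtain L where L: "L \<ge> 0" "?l = ennreal L" by (cases ?l) auto
  have "ennreal (L * mass) = ennreal J"
    using eq \<open>ennreal J = equator_energy TYPE('a)\<close> L by (simp add: ennreal_mult' mult.commute)
  then have LJ: "L * mass = J"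
    using L mass \<open>J \<ge> 0\<close> by simp
  have "L \<noteq> 0"
    using equator_energy_pos_finite(1)[OF dim] L unfolding eq[symmetric] by auto
  then have Lpos: "L > 0" using L by simp
  \<comment> \<open>Read off from the eigenvalue equation, which says that \<open>L\<close> times
    \<mu> has density D / |x - c|^2 on \<Omega>.\<close>
  define C where "C = D / L"
  have C: "C > 0" using D Lpos by (simp add: C_def)
  have box: "measure \<mu> (box a q \<inter> space \<mu>) = (LINT x:\<Omega>|lborel. indicator (box a q) x * (C * (1 / (norm (x - c))\<^sup>2)))" for a q
  proof -
    have "L * measure \<mu> (box a q \<inter> space \<mu>) = (LINT x:\<Omega>|lborel. indicator (box a q) x * (D * (1 / (norm (x - c))\<^sup>2)))"
      using measure_box_eq[OF dim mass c L] LJ unfolding J_def D_def by blast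
    also have "\<dots> = (LINT x:\<Omega>|lborel. L * (indicator (box a q) x * (C * (1 / (norm (x - c))\<^sup>2))))"
      using Lpos by (intro set_lebesgue_integral_cong) (auto simp: C_def)
    also have "\<dots> = L * (LINT x:\<Omega>|lborel. indicator (box a q) x * (C * (1 / (norm (x - c))\<^sup>2)))"
      by (rule set_integral_mult_right)
    finally show ?thesis using Lpos by simp
  qed
  show "\<exists>T C. isometry T \<and> C > 0 \<and> sym_diff (T ` \<Omega>) (ball 0 1) \<in> null_sets lborel \<and>
         distr \<mu> borel T = density lborel (\<lambda>x. ennreal (C / (norm x)\<^sup>2) * indicator (ball 0 1) x)"
  proof (intro exI conjI)
    show "isometry (\<lambda>x. x - c)"
      unfolding isometry_def
    proof
      show "surj (\<lambda>x. x - c)" by (rule surjI[of _ "\<lambda>x. x + c"]) simp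
    qed (simp add: dist_norm)
    show "C > 0" by (rule C)
    show "sym_diff ((\<lambda>x. x - c) ` \<Omega>) (ball 0 1) \<in> null_sets lborel"
    proof -
      have "x \<in> (\<lambda>x. x - c) ` \<Omega> \<longleftrightarrow> x - (- c) \<in> \<Omega>" for x
        by (auto simp: image_iff intro: bexI[of _ "x + c"])
      moreover have "x \<in> ball 0 1 \<longleftrightarrow> x - (- c) \<in> ball c 1" for x
        by (simp add: dist_norm)
      ultimately have "sym_diff ((\<lambda>x. x - c) ` \<Omega>) (ball 0 1) = {x. x - (- c) \<in> sym_diff \<Omega> (ball c 1)}"
        by blast
      then show ?thesis using null_sets_translation[OF null, of "- c"] by (simp only:)
    qed
    show "distr \<mu> borel (\<lambda>x. x - c) = density lborel (\<lambda>x. ennreal (C / (norm x)\<^sup>2) * indicator (ball 0 1) x)"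
      using C by (intro distr_translation_eq_density null int box) simp
  qed
qed

end

theorem theorem1p9:
  fixes \<Omega> :: "'a::euclidean_space set" and \<mu> :: "'a measure"
  assumes "DIM('a) \<ge> 3"
    and "admissible_domain \<Omega>"
    and "emeasure lborel \<Omega> = emeasure lborel (ball (0::'a) 1)"
    and "radon_measure_on (closure \<Omega>) \<mu>"
    and "nonatomic \<mu>"
  shows "normalized_neumann_eigenvalue 1 \<Omega> \<mu> \<le> equator_energy TYPE('a) \<and>
    (normalized_neumann_eigenvalue 1 \<Omega> \<mu> = equator_energy TYPE('a) \<longrightarrow>
      (\<exists>T C. isometry T \<and> C > 0 \<and>
         sym_diff (T ` \<Omega>) (ball 0 1) \<in> null_sets lborel \<and>
         distr \<mu> borel T =
           density lborel (\<lambda>x. ennreal (C / (norm x)\<^sup>2) * indicator (ball 0 1) x)))"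
proof -
  have \<Omega>: "open \<Omega>" "bounded \<Omega>" using assms(2) by (auto simp: admissible_domain_def)
  have sets: "sets \<mu> = sets (restrict_space borel (closure \<Omega>))"
    using assms(4) by (simp add: radon_measure_on_def)
  then have space: "space \<mu> = closure \<Omega>"
    using sets_eq_imp_space_eq[OF sets] by (simp add: space_restrict_space)
  \<comment> \<open>A Radon measure is finite on compact sets, and the closure of a bounded domain
    is one.\<close>
  have fin: "emeasure \<mu> (closure \<Omega>) < \<infinity>"
  proof -
    have "\<forall>K. compact K \<and> K \<subseteq> closure \<Omega> \<longrightarrow> emeasure \<mu> K < \<infinity>"
      using assms(4) unfolding radon_measure_on_def by (elim conjE)
    moreover have "compact (closure \<Omega>)" using \<Omega>(2) by simp
    ultimately show ?thesis by blast
  qed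
  interpret nonatomic_neumann_problem \<mu> \<Omega>
  proof (intro nonatomic_neumann_problem.intro neumann_problem.intro finite_measureI
      neumann_problem_axioms.intro nonatomic_neumann_problem_axioms.intro \<Omega> sets assms(5))
    show "emeasure \<mu> (space \<mu>) \<noteq> \<infinity>" using fin unfolding space by (rule less_imp_neq)
  qed
  show ?thesis
  proof (cases "emeasure \<mu> (closure \<Omega>) = 0")
    \<comment> \<open>The normalised eigenvalue is 0 by convention here, and the energy is positive,
      so the implication for equality is vacuous.\<close>
    case True
    then have "normalized_neumann_eigenvalue 1 \<Omega> \<mu> = 0"
      by (simp add: normalized_neumann_eigenvalue_def)
    moreover have "equator_energy TYPE('a) \<noteq> 0"
      using equator_energy_pos_finite(1)[OF assms(1)] by simp
    ultimately show ?thesis by simp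
  next
    case False
    then have mass: "mass > 0"
      by (simp add: space emeasure_eq_measure zero_less_measure_iff)
    have "normalized_neumann_eigenvalue 1 \<Omega> \<mu> = ennreal mass * neumann_eigenvalue 1 \<Omega> \<mu>"
      using False by (simp add: normalized_neumann_eigenvalue_def space emeasure_eq_measure)
    then show ?thesis
      using neumann_eigenvalue_mass_le[OF assms(1,3) mass] by simp
  qed
qed

end
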